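(* Let $X$ be a non-locally convex quasi-Banach space and let $I=[0,1]$. Then there exists a function $f:I\to X$ that is continuous and Riemann-integrable such that its average function $\operatorname{Ave}[f]:I\times I\to X$ is bounded but fails to be separately continuous.
   Context: Quasi-Banach spaces are real: $X$ is a real vector space with a complete quasi-norm $\|\cdot\|$ (i.e. $\|x\|>0$ for $x\ne0$, $\|\alpha x\|=|\alpha|\|x\|$, $\|x+y\|\le\kappa(\|x\|+\|y\|)$ for some constant $\kappa\ge1$), with the vector topology induced by the quasi-norm; $X$ is non-locally convex if this topology is not locally convex (equivalently, $X$ is not isomorphic to a Banach space). A function $f:[a,b]\to X$ is Riemann-integrable if its Riemann sums over tagged partitions converge in $X$ as the mesh of the partition tends to $0$; the limit is $\int_a^b f(u)\,du$. A function that is Riemann-integrable on $I$ is Riemann-integrable on each compact subinterval. For $f:I\to X$ continuous and Riemann-integrable, the average function $\operatorname{Ave}[f]:I\times I\to X$ is defined by $$\operatorname{Ave}[f](s,t)=\begin{cases}\frac{1}{t-s}\int_s^t f(u)\,du, & 0\le s<t\le 1,\\ f(c), & 0\le s=t=c\le 1,\\ \frac{1}{s-t}\int_t^s f(u)\,du, & 0\le t<s\le 1.\end{cases}$$ It is bounded if $\sup_{0\le s,t\le1}\|\operatorname{Ave}[f](s,t)\|<\infty$; separately continuous if for all $s_0,t_0\in I$, $\lim_{s\to s_0}\operatorname{Ave}[f](s,t_0)=\lim_{t\to t_0}\operatorname{Ave}[f](s_0,t)=\operatorname{Ave}[f](s_0,t_0)$. *)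

theory Defs
  imports "HOL-Analysis.Analysis"
begin

definition quasi_norm_topology :: "('a::real_vector \<Rightarrow> real) \<Rightarrow> 'a topology" where
  "quasi_norm_topology q =
     topology (\<lambda>U. \<forall>x\<in>U. \<exists>e>0. \<forall>y. q (y - x) < e \<longrightarrow> y \<in> U)"

lemma openin_quasi_norm_topology:
  "openin (quasi_norm_topology q) U \<longleftrightarrow> (\<forall>x\<in>U. \<exists>e>0. \<forall>y. q (y - x) < e \<longrightarrow> y \<in> U)"
proof -
  have "istopology (\<lambda>U. \<forall>x\<in>U. \<exists>e>0. \<forall>y. q (y - x) < e \<longrightarrow> y \<in> U)"
    unfolding istopology_def
  proof (intro conjI allI impI ballI)
    fix S T x
    assume S: "\<forall>x\<in>S. \<exists>e>0. \<forall>y. q (y - x) < e \<longrightarrow> y \<in> S"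
      and T: "\<forall>x\<in>T. \<exists>e>0. \<forall>y. q (y - x) < e \<longrightarrow> y \<in> T" and x: "x \<in> S \<inter> T"
    obtain d e where "d > 0" "e > 0" "\<forall>y. q (y - x) < d \<longrightarrow> y \<in> S" "\<forall>y. q (y - x) < e \<longrightarrow> y \<in> T"
      using S T x by blast
    then show "\<exists>e>0. \<forall>y. q (y - x) < e \<longrightarrow> y \<in> S \<inter> T"
      by (intro exI[of _ "min d e"]) auto
  next
    fix K x
    assume K: "\<forall>S\<in>K. \<forall>x\<in>S. \<exists>e>0. \<forall>y. q (y - x) < e \<longrightarrow> y \<in> S" and "x \<in> \<Union>K"
    then show "\<exists>e>0. \<forall>y. q (y - x) < e \<longrightarrow> y \<in> \<Union>K"
      by (meson UnionE UnionI)
  qed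
  then show ?thesis
    by (simp add: quasi_norm_topology_def)
qed

lemma topspace_quasi_norm_topology [simp]: "topspace (quasi_norm_topology q) = UNIV"
proof -
  have "openin (quasi_norm_topology q) UNIV"
    unfolding openin_quasi_norm_topology by (auto intro: exI[of _ 1])
  then show ?thesis
    using openin_subset by blast
qed

text \<open>For a vector topology a base of convex neighbourhoods at the origin suffices.\<close>

definition locally_convex_topology :: "'a::real_vector topology \<Rightarrow> bool" where
  "locally_convex_topology T \<longleftrightarrow> neighbourhood_base_at 0 convex T"

locale quasi_banach_space =
  fixes q :: "'a::real_vector \<Rightarrow> real"
  assumes qnorm_pos: "x \<noteq> 0 \<Longrightarrow> q x > 0"
    and qnorm_scaleR: "q (\<alpha> *\<^sub>R x) = \<bar>\<alpha>\<bar> * q x"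
    and qnorm_quasi_triangle: "\<exists>\<kappa>\<ge>1. \<forall>x y. q (x + y) \<le> \<kappa> * (q x + q y)"
    and qnorm_complete:
      "(\<forall>e>0. \<exists>M. \<forall>m\<ge>M. \<forall>n\<ge>M. q (X m - X n) < e)
        \<Longrightarrow> \<exists>l. limitin (quasi_norm_topology q) X l sequentially"
begin

lemma qnorm_zero: "q 0 = 0"
  using qnorm_scaleR[of 0 0] by simp

lemma qnorm_minus: "q (- x) = q x"
  using qnorm_scaleR[of "-1" x] by simp

lemma limitin_quasi_norm_topology:
  "limitin (quasi_norm_topology q) g l F \<longleftrightarrow> (\<forall>e>0. eventually (\<lambda>i. q (g i - l) < e) F)"
proof
  assume lim: "limitin (quasi_norm_topology q) g l F"
  obtain \<kappa> where \<kappa>: "\<kappa> \<ge> 1" "\<And>x y. q (x + y) \<le> \<kappa> * (q x + q y)"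
    using qnorm_quasi_triangle by blast
  show "\<forall>e>0. eventually (\<lambda>i. q (g i - l) < e) F"
  proof (intro allI impI)
    fix e :: real assume "e > 0"
    define U where "U = {x. \<exists>d>0. \<forall>y. q (y - x) < d \<longrightarrow> q (y - l) < e}"
    have "openin (quasi_norm_topology q) U"
      unfolding openin_quasi_norm_topology
    proof
      fix x assume "x \<in> U"
      then obtain d where d: "d > 0" "\<And>y. q (y - x) < d \<Longrightarrow> q (y - l) < e"
        unfolding U_def by blast
      define d' where "d' = d / (2 * \<kappa>)"
      have "d' > 0" using d \<kappa> by (simp add: d'_def)
      have "y \<in> U" if "q (y - x) < d'" for y
        unfolding U_def
      proof (intro CollectI exI conjI allI impI)
        fix z assume z: "q (z - y) < d'"
        have "q (z - x) \<le> \<kappa> * (q (z - y) + q (y - x))"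
          using \<kappa>(2)[of "z - y" "y - x"] by simp
        also have "\<dots> < \<kappa> * (d' + d')"
          using z that \<kappa>(1) by (intro mult_strict_left_mono) auto
        also have "\<dots> = d" using \<kappa>(1) by (simp add: d'_def field_simps)
        finally show "q (z - l) < e" by (rule d)
      qed (fact \<open>d' > 0\<close>)
      then show "\<exists>e>0. \<forall>y. q (y - x) < e \<longrightarrow> y \<in> U" using \<open>d' > 0\<close> by blast
    qed
    moreover have "l \<in> U" using \<open>e > 0\<close> unfolding U_def by auto
    ultimately have "eventually (\<lambda>i. g i \<in> U) F"
      using lim by (simp add: limitin_def)
    then show "eventually (\<lambda>i. q (g i - l) < e) F"
      by (rule eventually_mono) (auto simp: U_def qnorm_zero)
  qed
next
  assume ev: "\<forall>e>0. eventually (\<lambda>i. q (g i - l) < e) F"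
  show "limitin (quasi_norm_topology q) g l F"
    unfolding limitin_def
  proof (intro conjI allI impI)
    fix U assume "openin (quasi_norm_topology q) U \<and> l \<in> U"
    then obtain e where "e > 0" "\<And>y. q (y - l) < e \<Longrightarrow> y \<in> U"
      unfolding openin_quasi_norm_topology by blast
    then show "eventually (\<lambda>i. g i \<in> U) F"
      using ev by (meson eventually_mono)
  qed simp
qed

lemma limitin_quasi_norm_topology_unique:
  assumes "limitin (quasi_norm_topology q) g l F" "limitin (quasi_norm_topology q) g m F" "F \<noteq> bot"
  shows "l = m"
proof (rule ccontr)
  assume "l \<noteq> m"
  obtain \<kappa> where \<kappa>: "\<kappa> \<ge> 1" "\<And>x y. q (x + y) \<le> \<kappa> * (q x + q y)"
    using qnorm_quasi_triangle by blast
  define e where "e = q (m - l) / (2 * \<kappa>)"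
  have "e > 0" using \<open>l \<noteq> m\<close> \<kappa> qnorm_pos[of "m - l"] by (simp add: e_def)
  then have "eventually (\<lambda>i. q (g i - l) < e \<and> q (g i - m) < e) F"
    using assms by (simp add: limitin_quasi_norm_topology eventually_conj)
  then obtain i where i: "q (g i - l) < e" "q (g i - m) < e"
    using assms(3) eventually_happens by fastforce
  have "q (m - l) \<le> \<kappa> * (q (m - g i) + q (g i - l))"
    using \<kappa>(2)[of "m - g i" "g i - l"] by simp
  also have "\<dots> < \<kappa> * (e + e)"
    using i \<kappa>(1) qnorm_minus[of "g i - m"] by (intro mult_strict_left_mono) auto
  also have "\<dots> = q (m - l)" using \<kappa>(1) by (simp add: e_def field_simps)
  finally show False by simp
qed

end

text \<open>Unlike \<^const>\<open>division_filter\<close>, which refines along arbitrary gauges (Henstock--Kurzweil),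
  this filter bounds the mesh uniformly (Riemann).\<close>

definition mesh_filter :: "real \<Rightarrow> real \<Rightarrow> (real \<times> real set) set filter" where
  "mesh_filter a b =
     (INF \<delta>\<in>{0<..}. principal {p. p tagged_division_of {a..b} \<and> (\<forall>(x, K)\<in>p. measure lborel K < \<delta>)})"

lemma eventually_mesh_filter:
  "eventually P (mesh_filter a b) \<longleftrightarrow>
     (\<exists>\<delta>>0. \<forall>p. p tagged_division_of {a..b} \<and> (\<forall>(x, K)\<in>p. measure lborel K < \<delta>) \<longrightarrow> P p)"
proof -
  define S where
    "S = (\<lambda>\<delta>. {p. p tagged_division_of {a..b} \<and> (\<forall>(x, K)\<in>p. measure lborel K < \<delta>)})"
  have "eventually P (mesh_filter a b) \<longleftrightarrow> (\<exists>\<delta>\<in>{0<..}. eventually P (principal (S \<delta>)))"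
  proof (subst eventually_INF_base[symmetric])
    fix d e :: real assume "d \<in> {0<..}" "e \<in> {0<..}"
    then show "\<exists>x\<in>{0<..}. principal (S x) \<le> inf (principal (S d)) (principal (S e))"
      by (intro bexI[of _ "min d e"]) (auto simp: S_def)
  qed (auto simp: mesh_filter_def S_def)
  then show ?thesis
    by (auto simp: eventually_principal S_def)
qed

lemma mesh_filter_neq_bot: "a \<le> b \<Longrightarrow> mesh_filter a b \<noteq> bot"
proof -
  assume "a \<le> b"
  have "\<exists>p. p tagged_division_of {a..b} \<and> (\<forall>(x, K)\<in>p. measure lborel K < \<delta>)" if "\<delta> > 0" for \<delta>
  proof -
    have "gauge (\<lambda>x::real. ball x (\<delta> / 3))" using that by (auto simp: gauge_def)
    then obtain p where p: "p tagged_division_of {a..b}" "(\<lambda>x. ball x (\<delta> / 3)) fine p"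
      by (metis fine_division_exists_real)
    have "measure lborel K < \<delta>" if xK: "(x, K) \<in> p" for x K
    proof -
      obtain c d where K: "K = {c..d}" "x \<in> K"
        using tagged_division_ofD(2,4)[OF p(1) xK] by auto
      moreover have "K \<subseteq> ball x (\<delta> / 3)" using p(2) xK by (auto simp: fine_def)
      moreover have "c \<in> K" "d \<in> K" "c \<le> d" using K by auto
      ultimately have "c \<in> ball x (\<delta> / 3)" "d \<in> ball x (\<delta> / 3)" "c \<le> d" by blast+
      then show ?thesis using K \<open>\<delta> > 0\<close> by (auto simp: dist_real_def)
    qed
    then show ?thesis using p(1) by blast
  qed
  then show ?thesis
    unfolding trivial_limit_def eventually_mesh_filter by meson
qed

definition has_riemann_integral ::
    "('a::real_vector \<Rightarrow> real) \<Rightarrow> (real \<Rightarrow> 'a) \<Rightarrow> 'a \<Rightarrow> real \<Rightarrow> real \<Rightarrow> bool" where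
  "has_riemann_integral q f L a b \<longleftrightarrow>
     limitin (quasi_norm_topology q) (\<lambda>p. \<Sum>(x, K)\<in>p. measure lborel K *\<^sub>R f x) L (mesh_filter a b)"

definition riemann_integrable ::
    "('a::real_vector \<Rightarrow> real) \<Rightarrow> (real \<Rightarrow> 'a) \<Rightarrow> real \<Rightarrow> real \<Rightarrow> bool" where
  "riemann_integrable q f a b \<longleftrightarrow> (\<exists>L. has_riemann_integral q f L a b)"

definition riemann_integral ::
    "('a::real_vector \<Rightarrow> real) \<Rightarrow> (real \<Rightarrow> 'a) \<Rightarrow> real \<Rightarrow> real \<Rightarrow> 'a" where
  "riemann_integral q f a b = (THE L. has_riemann_integral q f L a b)"

lemma (in quasi_banach_space) riemann_integral_unique:
  assumes "has_riemann_integral q f L a b" "a \<le> b"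
  shows "riemann_integral q f a b = L"
  using assms limitin_quasi_norm_topology_unique[OF _ _ mesh_filter_neq_bot]
  unfolding riemann_integral_def has_riemann_integral_def by (intro the_equality) blast+

definition Ave :: "('a::real_vector \<Rightarrow> real) \<Rightarrow> (real \<Rightarrow> 'a) \<Rightarrow> real \<Rightarrow> real \<Rightarrow> 'a" where
  "Ave q f s t =
     (if s < t then (1 / (t - s)) *\<^sub>R riemann_integral q f s t
      else if s = t then f s
      else (1 / (s - t)) *\<^sub>R riemann_integral q f t s)"

definition bounded_on_square :: "('a::real_vector \<Rightarrow> real) \<Rightarrow> (real \<Rightarrow> real \<Rightarrow> 'a) \<Rightarrow> bool" where
  "bounded_on_square q A \<longleftrightarrow> bdd_above ((\<lambda>(s, t). q (A s t)) ` ({0..1} \<times> {0..1}))"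

definition separately_continuous ::
    "('a::real_vector \<Rightarrow> real) \<Rightarrow> (real \<Rightarrow> real \<Rightarrow> 'a) \<Rightarrow> bool" where
  "separately_continuous q A \<longleftrightarrow>
     (\<forall>s0\<in>{0..1}. \<forall>t0\<in>{0..1}.
        limitin (quasi_norm_topology q) (\<lambda>s. A s t0) (A s0 t0) (at s0 within {0..1}) \<and>
        limitin (quasi_norm_topology q) (\<lambda>t. A s0 t) (A s0 t0) (at t0 within {0..1}))"

end

theory Submission
  imports Defs
begin

text \<open>
  Let \<open>1 = t 0 > t 1 > \<dots>\<close> decrease to 0 and let \<open>f\<close> be, on \<open>[t (j + 1), t j]\<close>, the multiple by a
  vector \<open>x j\<close> of a bump with integral \<open>t j - t (j + 1)\<close>. If \<open>x j\<close> tends to 0, then \<open>f\<close> is continuous.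
  If the lengths decrease so fast that \<open>\<Sum>j. \<kappa> ^ j * (t j - t (j + 1))\<close> converges, where \<open>\<kappa>\<close> is the
  modulus of concavity, then all Riemann sums of \<open>f\<close> are bounded by a constant times \<open>sup j. q (x j)\<close>;
  as \<open>f\<close> is a uniform limit of finite sums of bumps, it is Riemann-integrable.

  In a space that is not locally convex, some convex combination of small vectors has quasi-norm 1
  while all averages over contiguous parts of it have quasi-norm at most 1. Concatenating such blocks
  with ever smaller vectors gives \<open>x\<close>. If every block is much shorter than the preceding one, the
  averages of \<open>f\<close> are bounded, while its average over \<open>[0, b]\<close>, with \<open>b\<close> the right end of a block, is
  dominated by that block and stays away from \<open>f 0 = 0\<close>.
\<close>

section \<open>Sums in quasi-Banach spaces and Riemann sums of real functions\<close>

text \<open>Fixes one admissible constant \<open>\<kappa>\<close>, whose existence alone is part of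
  \<open>quasi_banach_space\<close>, so that all later bounds can be explicit in it.\<close>

locale quasi_banach_modulus = quasi_banach_space q
  for q :: "'a::real_vector \<Rightarrow> real" +
  fixes \<kappa> :: real
  assumes \<kappa>_ge_1: "\<kappa> \<ge> 1"
    and quasi_triangle: "q (x + y) \<le> \<kappa> * (q x + q y)"
begin

lemma qnorm_nonneg [simp]: "0 \<le> q x"
  using qnorm_pos[of x] qnorm_zero by (cases "x = 0") auto

lemma \<kappa>_pos: "\<kappa> > 0"
  using \<kappa>_ge_1 by simp

text \<open>Splitting off the first summand costs a factor \<open>\<kappa>\<close> each time, so the
  summand with index \<open>i\<close> collects \<open>\<kappa> ^ Suc i\<close>. This geometric
  growth is what the interval lengths have to outweigh.\<close>

lemma qnorm_sum_le: "q (\<Sum>i<n. z i) \<le> (\<Sum>i<n. \<kappa> ^ Suc i * q (z i))"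
proof (induction n arbitrary: z)
  case 0
  then show ?case by (simp add: qnorm_zero)
next
  case (Suc n)
  have "q (\<Sum>i<Suc n. z i) \<le> \<kappa> * (q (z 0) + q (\<Sum>i<n. z (Suc i)))"
    using quasi_triangle by (simp add: sum.lessThan_Suc_shift del: sum.lessThan_Suc)
  also have "\<dots> \<le> \<kappa> * (q (z 0) + (\<Sum>i<n. \<kappa> ^ Suc i * q (z (Suc i))))"
    using Suc.IH[of "\<lambda>i. z (Suc i)"] \<kappa>_pos by (intro mult_left_mono add_mono) auto
  also have "\<dots> = (\<Sum>i<Suc n. \<kappa> ^ Suc i * q (z i))"
    by (simp add: sum.lessThan_Suc_shift sum_distrib_left algebra_simps del: sum.lessThan_Suc)
  finally show ?case .
qed

text \<open>A quasi-norm need not be continuous, so the limit is obtained by an estimate: induction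
  on \<open>A\<close> with one quasi-triangle inequality per vector.\<close>

lemma tendsto_qnorm_sum_zero:
  assumes "finite A" "\<And>a. a \<in> A \<Longrightarrow> ((\<lambda>i. r i a) \<longlongrightarrow> 0) F"
  shows "((\<lambda>i. q (\<Sum>a\<in>A. r i a *\<^sub>R v a)) \<longlongrightarrow> 0) F"
  using assms
proof (induction A rule: finite_induct)
  case empty
  then show ?case by (simp add: qnorm_zero)
next
  case (insert a A)
  have lim: "((\<lambda>i. \<kappa> * (\<bar>r i a\<bar> * q (v a) + q (\<Sum>a\<in>A. r i a *\<^sub>R v a))) \<longlongrightarrow> \<kappa> * (\<bar>0\<bar> * q (v a) + 0)) F"
    using insert by (intro tendsto_intros) auto
  have bd: "q (\<Sum>a\<in>insert a A. r i a *\<^sub>R v a)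
      \<le> \<kappa> * (\<bar>r i a\<bar> * q (v a) + q (\<Sum>a\<in>A. r i a *\<^sub>R v a))" for i
    using insert.hyps quasi_triangle[of "r i a *\<^sub>R v a"] by (simp add: qnorm_scaleR)
  show ?case
    by (rule tendsto_sandwich[OF _ _ tendsto_const lim[simplified]]) (use bd in auto)
qed

end

section \<open>Tagged divisions and scalar Riemann sums\<close>

lemma tagged_division_of_interval:
  fixes a b :: real
  assumes "p tagged_division_of {a..b}" "(\<xi>, K) \<in> p"
  shows "K = {Inf K..Sup K}" "Inf K \<le> \<xi>" "\<xi> \<le> Sup K" "a \<le> Inf K" "Sup K \<le> b"
    "measure lborel K = Sup K - Inf K"
proof -
  obtain c d where cd: "K = {c..d}" "\<xi> \<in> K" "K \<subseteq> {a..b}"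
    using tagged_division_ofD(2-4)[OF assms] by auto
  then have "c \<le> d" by auto
  then have "Inf K = c" "Sup K = d" using cd by auto
  then show "K = {Inf K..Sup K}" "Inf K \<le> \<xi>" "\<xi> \<le> Sup K" "a \<le> Inf K" "Sup K \<le> b"
    "measure lborel K = Sup K - Inf K"
    using cd \<open>c \<le> d\<close> by auto
qed

lemma tagged_division_of_overlap:
  fixes a b :: real
  assumes p: "p tagged_division_of {a..b}" and "(\<xi>, K) \<in> p" "(\<eta>, L) \<in> p"
    and "max (Inf K) (Inf L) < min (Sup K) (Sup L)"
  shows "(\<xi>, K) = (\<eta>, L)"
proof (rule ccontr)
  assume "(\<xi>, K) \<noteq> (\<eta>, L)"
  then have "interior K \<inter> interior L = {}"
    using tagged_division_ofD(5)[OF p] assms by blast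
  moreover obtain z where z: "max (Inf K) (Inf L) < z" "z < min (Sup K) (Sup L)"
    using assms(4) dense by blast
  have "interior K = {Inf K<..<Sup K}" "interior L = {Inf L<..<Sup L}"
    using tagged_division_of_interval(1)[OF p] assms(2,3) interior_atLeastAtMost_real by metis+
  then have "z \<in> interior K \<inter> interior L"
    using z by auto
  ultimately show False by blast
qed

text \<open>By uniform continuity a single mesh bound keeps the error on each cell below
  \<open>e'\<close> times its length, as convergence along \<open>mesh_filter\<close>
  demands.\<close>

lemma riemann_sums_tendsto_integral:
  fixes g :: "real \<Rightarrow> real"
  assumes cont: "continuous_on {a..b} g" and "a \<le> b"
  shows "((\<lambda>p. \<Sum>(\<xi>, K)\<in>p. measure lborel K * g \<xi>) \<longlongrightarrow> integral {a..b} g) (mesh_filter a b)"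
proof (rule tendstoI)
  fix e :: real assume "e > 0"
  \<comment> \<open>The summand 1 keeps the denominator positive when \<open>a = b\<close>.\<close>
  define e' where "e' = e / (2 * (b - a + 1))"
  have e': "e' > 0" "e' * (b - a) < e"
    using \<open>e > 0\<close> \<open>a \<le> b\<close> by (auto simp: e'_def divide_simps)
  have "uniformly_continuous_on {a..b} g"
    using cont compact_uniformly_continuous by blast
  then obtain \<delta> where \<delta>: "\<delta> > 0"
    "\<And>x y. x \<in> {a..b} \<Longrightarrow> y \<in> {a..b} \<Longrightarrow> dist y x < \<delta> \<Longrightarrow> dist (g y) (g x) < e'"
    using e'(1) unfolding uniformly_continuous_on_def by metis
  have "dist (\<Sum>(\<xi>, K)\<in>p. measure lborel K * g \<xi>) (integral {a..b} g) < e"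
    if p: "p tagged_division_of {a..b}" and mesh: "\<forall>(\<xi>, K)\<in>p. measure lborel K < \<delta>" for p
  proof -
    have int: "g integrable_on {a..b}"
      using cont integrable_continuous_real by blast
    have "integral {a..b} g = (\<Sum>(\<xi>, K)\<in>p. integral K g)"
      using integral_combine_tagged_division_topdown[of g a b p] int p by simp
    then have "dist (\<Sum>(\<xi>, K)\<in>p. measure lborel K * g \<xi>) (integral {a..b} g)
        = \<bar>\<Sum>(\<xi>, K)\<in>p. measure lborel K * g \<xi> - integral K g\<bar>"
      by (simp add: dist_real_def sum_subtractf case_prod_unfold)
    also have "\<dots> \<le> (\<Sum>(\<xi>, K)\<in>p. e' * (Sup K - Inf K))"
    proof (rule order_trans[OF sum_abs sum_mono], clarify)
      fix \<xi> K assume xK: "(\<xi>, K) \<in> p"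
      note K = tagged_division_of_interval[OF p xK]
      have sub: "K \<subseteq> {a..b}" using tagged_division_ofD(3)[OF p xK] .
      have intK: "g integrable_on K"
        using integrable_on_subinterval[OF int, of "Inf K" "Sup K"] K(1) sub by simp
      have "((\<lambda>s. g \<xi> - g s) has_integral (g \<xi> * (Sup K - Inf K) - integral K g)) {Inf K..Sup K}"
      proof (rule has_integral_diff)
        show "((\<lambda>s. g \<xi>) has_integral g \<xi> * (Sup K - Inf K)) {Inf K..Sup K}"
          using has_integral_const_real[of "g \<xi>" "Inf K" "Sup K"] K(2,3) by (simp add: mult.commute)
        show "(g has_integral integral K g) {Inf K..Sup K}"
          using intK K(1) integrable_integral by metis
      qed
      moreover have "norm (g \<xi> - g s) \<le> e'" if "s \<in> {Inf K..Sup K}" for s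
      proof -
        have "dist s \<xi> < \<delta>" 
          using bspec[OF mesh xK] K(2,3,6) that by (auto simp: dist_real_def)
        moreover have "s \<in> {a..b}" "\<xi> \<in> {a..b}" using K(2-5) that by auto
        ultimately have "dist (g s) (g \<xi>) < e'" by (intro \<delta>(2))
        then show ?thesis by (simp add: dist_real_def abs_minus_commute)
      qed
      ultimately have "norm (g \<xi> * (Sup K - Inf K) - integral K g) \<le> e' * (Sup K - Inf K)"
        using has_integral_bound_real[of e' "{}" "\<lambda>s. g \<xi> - g s" _ "Inf K" "Sup K"] e'(1) K(2,3) by auto
      then show "\<bar>measure lborel K * g \<xi> - integral K g\<bar> \<le> e' * (Sup K - Inf K)"
        using K(6) by (simp add: mult.commute)
    qed
    also have "\<dots> = e' * (\<Sum>(\<xi>, K)\<in>p. Sup K - Inf K)"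
      by (simp add: sum_distrib_left case_prod_unfold)
    also have "\<dots> = e' * (b - a)"
      using additive_tagged_division_1[OF \<open>a \<le> b\<close> p, of "\<lambda>s. s"] by simp
    finally show ?thesis using e'(2) by simp
  qed
  then show "eventually (\<lambda>p. dist (\<Sum>(\<xi>, K)\<in>p. measure lborel K * g \<xi>) (integral {a..b} g) < e)
      (mesh_filter a b)"
    unfolding eventually_mesh_filter using \<delta>(1) by blast
qed

section \<open>Partitions accumulating at zero\<close>

locale null_partition =
  fixes t :: "nat \<Rightarrow> real"
  assumes t_0: "t 0 = 1"
    and t_Suc_less: "t (Suc j) < t j"
    and t_tendsto: "t \<longlonglongrightarrow> 0"
begin

definition len :: "nat \<Rightarrow> real" where
  "len j = t j - t (Suc j)"

lemma len_pos: "len j > 0"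
  using t_Suc_less by (simp add: len_def)

lemma t_antimono: "i \<le> j \<Longrightarrow> t j \<le> t i"
  using lift_Suc_antimono_le[of t] t_Suc_less less_imp_le by metis

lemma t_pos: "t j > 0"
proof -
  have "t (Suc j) \<ge> 0"
    using decseq_ge[OF _ t_tendsto] t_antimono by (simp add: decseq_def)
  then show ?thesis using t_Suc_less[of j] by simp
qed

lemma t_le_1: "t j \<le> 1"
  using t_antimono[of 0 j] t_0 by simp

lemma sum_len: "u \<le> v \<Longrightarrow> (\<Sum>j\<in>{u..<v}. len j) = t u - t v"
  by (induction v rule: dec_induct) (auto simp: len_def)

text \<open>The positive part of a parabola vanishing at both ends of the \<open>j\<close>-th
  interval. The factor 6 makes its integral equal to \<open>len j\<close>, that is, its mean over
  the interval equal to 1.\<close>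

definition bump :: "nat \<Rightarrow> real \<Rightarrow> real" where
  "bump j s = max 0 (6 * ((s - t (Suc j)) * (t j - s) / (len j)\<^sup>2))"

lemma bump_nonneg: "bump j s \<ge> 0"
  by (simp add: bump_def)

lemma bump_le_2: "bump j s \<le> 2"
proof -
  have "3 * (u * v) \<le> (u + v)\<^sup>2" for u v :: real
  proof -
    have "0 \<le> (u - v)\<^sup>2 + u\<^sup>2 + v\<^sup>2" by simp
    then show ?thesis by (simp add: power2_eq_square algebra_simps)
  qed
  from this[of "s - t (Suc j)" "t j - s"]
  have "3 * ((s - t (Suc j)) * (t j - s)) \<le> 1 * (len j)\<^sup>2" by (simp add: len_def)
  then have "3 * ((s - t (Suc j)) * (t j - s)) / (len j)\<^sup>2 \<le> 1"
    using len_pos[of j] by (subst pos_divide_le_eq) auto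
  then show ?thesis
    by (simp add: bump_def)
qed

lemma bump_eq_0:
  assumes "s \<le> t (Suc j) \<or> t j \<le> s"
  shows "bump j s = 0"
proof -
  have "(s - t (Suc j)) * (t j - s) \<le> 0"
    using assms t_Suc_less[of j] by (auto simp: mult_le_0_iff)
  then have "(s - t (Suc j)) * (t j - s) / (len j)\<^sup>2 \<le> 0"
    by (intro divide_nonpos_nonneg) auto
  then show ?thesis
    by (simp add: bump_def)
qed

lemma bump_support: "bump j s \<noteq> 0 \<Longrightarrow> t (Suc j) < s \<and> s < t j"
  using bump_eq_0 not_le by blast

lemma bump_unique:
  assumes "bump i s \<noteq> 0" "bump j s \<noteq> 0"
  shows "i = j"
proof (rule ccontr)
  assume "i \<noteq> j"
  then have "t i \<le> t (Suc j) \<or> t j \<le> t (Suc i)"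
    using t_antimono by (metis Suc_leI linorder_neqE_nat)
  then show False using bump_support[OF assms(1)] bump_support[OF assms(2)] by auto
qed

lemma continuous_on_bump: "continuous_on A (bump j)"
  unfolding bump_def using len_pos[of j] by (intro continuous_intros) auto

lemma bump_integrable: "bump j integrable_on {a..b}"
  by (intro integrable_continuous_real continuous_on_bump)

lemma has_integral_bump: "(bump j has_integral len j) {t (Suc j)..t j}"
proof -
  define a b c where "a = t (Suc j)" and "b = t j" and "c = inverse ((b - a)\<^sup>2)"
  \<comment> \<open>An antiderivative of the parabola before taking the positive part;
    \<open>P a = 0\<close> and \<open>P b = b - a\<close>.\<close>
  define P where "P s = c * (3 * (b - a) * (s - a)\<^sup>2 - 2 * (s - a) ^ 3)" for s
  have "a < b" using t_Suc_less by (simp add: a_def b_def)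
  have "((\<lambda>s. c * (6 * (s - a) * (b - s))) has_integral (P b - P a)) {a..b}"
  proof (rule fundamental_theorem_of_calculus)
    fix s
    have "(P has_real_derivative c * (6 * (b - a) * (s - a) - 6 * (s - a)\<^sup>2)) (at s within {a..b})"
      unfolding P_def
      by (auto intro!: derivative_eq_intros simp: power2_eq_square algebra_simps)
    also have "6 * (b - a) * (s - a) - 6 * (s - a)\<^sup>2 = 6 * (s - a) * (b - s)"
      by (simp add: power2_eq_square algebra_simps)
    finally show "(P has_vector_derivative c * (6 * (s - a) * (b - s))) (at s within {a..b})"
      by (simp add: has_real_derivative_iff_has_vector_derivative)
  qed (use \<open>a < b\<close> in simp)
  moreover have "P b - P a = c * (b - a)\<^sup>2 * (b - a)"
    by (simp add: P_def power2_eq_square power3_eq_cube algebra_simps)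
  then have "P b - P a = b - a"
    using \<open>a < b\<close> by (simp add: c_def)
  moreover have "c * (6 * (s - a) * (b - s)) = bump j s" if "s \<in> {a..b}" for s
    using that by (simp add: bump_def a_def b_def c_def len_def divide_inverse max_def mult.commute)
  ultimately have "(bump j has_integral (b - a)) {a..b}"
    using has_integral_eq[of "{a..b}" "\<lambda>s. c * (6 * (s - a) * (b - s))" "bump j"] by metis
  then show ?thesis by (simp add: a_def b_def len_def)
qed

lemma has_integral_bump_superset:
  assumes "{t (Suc j)..t j} \<subseteq> A"
  shows "(bump j has_integral len j) A"
  by (rule has_integral_on_superset[OF has_integral_bump _ assms]) (auto simp: bump_eq_0 not_le)

section \<open>Integrals of bumps over subintervals\<close>

definition coef :: "real \<Rightarrow> real \<Rightarrow> nat \<Rightarrow> real" where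
  "coef a b j = integral {a..b} (bump j)"

lemma coef_nonneg: "coef a b j \<ge> 0"
  unfolding coef_def by (intro integral_nonneg bump_integrable bump_nonneg)

lemma coef_le_length:
  assumes "a \<le> b"
  shows "coef a b j \<le> 2 * (b - a)"
proof -
  have "integral {a..b} (bump j) \<le> integral {a..b} (\<lambda>_. 2)"
    by (intro integral_le bump_integrable bump_le_2) auto
  then show ?thesis using assms by (simp add: coef_def)
qed

lemma coef_le_len: "coef a b j \<le> len j"
proof -
  have "integral {a..b} (bump j) \<le> integral UNIV (bump j)"
    using has_integral_bump_superset[of j UNIV]
    by (intro integral_subset_le bump_integrable) (auto simp: integrable_on_def bump_nonneg)
  then show ?thesis
    using has_integral_bump_superset[of j UNIV] by (simp add: coef_def integral_unique)
qed

lemma coef_eq_len: "a \<le> t (Suc j) \<Longrightarrow> t j \<le> b \<Longrightarrow> coef a b j = len j"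
  unfolding coef_def by (intro integral_unique has_integral_bump_superset) auto

lemma coef_eq_0:
  assumes "b \<le> t (Suc j) \<or> t j \<le> a"
  shows "coef a b j = 0"
proof -
  have "integral {a..b} (bump j) = integral {a..b} (\<lambda>_. 0)"
    by (rule integral_cong) (use assms in \<open>auto intro!: bump_eq_0\<close>)
  then show ?thesis by (simp add: coef_def)
qed

text \<open>The length of the part of \<open>{0..s}\<close> lying in the \<open>j\<close>-th interval.\<close>

definition seg :: "nat \<Rightarrow> real \<Rightarrow> real" where
  "seg j s = min s (t j) - min s (t (Suc j))"

lemma sum_seg: "s \<le> 1 \<Longrightarrow> (\<Sum>j<n. seg j s) = s - min s (t n)"
  by (induction n) (auto simp: seg_def t_0)

lemma seg_mono: "a \<le> b \<Longrightarrow> seg j a \<le> seg j b"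
  using t_Suc_less[of j] by (auto simp: seg_def min_def)

lemma seg_diff_le_len: "seg j b - seg j a \<le> len j"
  using t_Suc_less[of j] by (auto simp: seg_def len_def min_def)

lemma seg_diff_pos: "seg j a < seg j b \<Longrightarrow> a < t j \<and> t (Suc j) < b"
  using t_Suc_less[of j] by (auto simp: seg_def min_def split: if_splits)

end

section \<open>Riemann sums of vector-valued bumps\<close>

locale bump_series = quasi_banach_modulus q \<kappa> + null_partition t
  for q :: "'a::real_vector \<Rightarrow> real" and \<kappa> :: real and t :: "nat \<Rightarrow> real" +
  assumes summable_len: "summable (\<lambda>j. \<kappa> ^ Suc j * len j)"
begin

text \<open>The pointwise sum of all \<open>bump j s *\<^sub>R x j\<close>. At most one bump is
  nonzero at \<open>s\<close>, so choosing its index replaces an infinite sum; where all bumps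
  vanish, every choice gives 0.\<close>

definition glue :: "(nat \<Rightarrow> 'a) \<Rightarrow> real \<Rightarrow> 'a" where
  "glue x s = (let j = SOME j. bump j s \<noteq> 0 in bump j s *\<^sub>R x j)"

lemma glue_eq:
  assumes "bump j s \<noteq> 0"
  shows "glue x s = bump j s *\<^sub>R x j"
proof -
  have "(SOME j. bump j s \<noteq> 0) = j"
    using assms by (intro some_equality bump_unique) auto
  then show ?thesis by (simp add: glue_def)
qed

lemma glue_eq_0: "(\<And>j. bump j s = 0) \<Longrightarrow> glue x s = 0"
  by (simp add: glue_def)

lemma glue_interval:
  assumes "t (Suc j) < s" "s < t j"
  shows "glue x s = bump j s *\<^sub>R x j"
proof (cases "bump j s = 0")
  case True
  have "bump i s = 0" for i
  proof (rule ccontr)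
    assume nz: "bump i s \<noteq> 0"
    then have "i \<noteq> j" using True by auto
    then have "t i \<le> t (Suc j) \<or> t j \<le> t (Suc i)"
      using t_antimono by (metis Suc_leI linorder_neqE_nat)
    then show False using bump_support[OF nz] assms by auto
  qed
  then show ?thesis using True by (simp add: glue_eq_0)
qed (rule glue_eq)

lemma qnorm_glue_le:
  assumes "\<And>j. q (x j) \<le> S"
  shows "q (glue x s) \<le> 2 * S"
proof (cases "\<exists>j. bump j s \<noteq> 0")
  case True
  then obtain j where "bump j s \<noteq> 0" by blast
  then have "q (glue x s) = bump j s * q (x j)"
    using bump_nonneg[of j s] by (simp add: glue_eq qnorm_scaleR)
  also have "\<dots> \<le> 2 * S"
    by (intro mult_mono bump_le_2 assms) auto
  finally show ?thesis .
next
  case False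
  have "0 \<le> S" using assms[of 0] qnorm_nonneg[of "x 0"] by linarith
  then show ?thesis using False by (simp add: glue_eq_0 qnorm_zero)
qed

text \<open>The tail of the series is again of the form \<open>glue\<close>, for a truncated
  sequence, so the uniform bounds on \<open>glue\<close> and on its Riemann sums apply to
  it.\<close>

lemma glue_split:
  "glue x s = (\<Sum>j<m. bump j s *\<^sub>R x j) + glue (\<lambda>j. if j < m then 0 else x j) s"
proof (cases "\<exists>j. bump j s \<noteq> 0")
  case True
  then obtain i where i: "bump i s \<noteq> 0" by blast
  have "(\<Sum>j<m. bump j s *\<^sub>R x j) = (\<Sum>j<m. if j = i then bump i s *\<^sub>R x i else 0)"
    using bump_unique[OF i] by (intro sum.cong) auto
  then show ?thesis using i by (simp add: glue_eq)
qed (simp add: glue_eq_0)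

text \<open>Of the intervals of a tagged division that meet the \<open>j\<close>-th interval of the partition, all but
  at most two have their tag inside it.\<close>

lemma qnorm_segment_sum_le:
  assumes p: "p tagged_division_of {a..b}" and "a \<le> b" and x: "\<And>j. q (x j) \<le> S"
  shows "q (\<Sum>(\<xi>, K)\<in>p. (seg j (Sup K) - seg j (Inf K)) *\<^sub>R glue x \<xi>) \<le> 6 * \<kappa>\<^sup>2 * (len j * S)"
proof -
  define w where "w K = seg j (Sup K) - seg j (Inf K)" for K
  \<comment> \<open>Cells meeting the \<open>j\<close>-th interval are sorted by their tag: inside
    it (\<open>T\<close>), to its right (\<open>U\<close>) or to its left
    (\<open>V\<close>).\<close>
  define T where "T = {(\<xi>, K)\<in>p. w K \<noteq> 0 \<and> t (Suc j) < \<xi> \<and> \<xi> < t j}"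
  define U where "U = {(\<xi>, K)\<in>p. w K \<noteq> 0 \<and> t j \<le> \<xi>}"
  define V where "V = {(\<xi>, K)\<in>p. w K \<noteq> 0 \<and> \<xi> \<le> t (Suc j)}"
  let ?g = "\<lambda>(\<xi>, K). w K *\<^sub>R glue x \<xi>"
  note K = tagged_division_of_interval[OF p]
  have fin: "finite p" using p by blast
  have S: "0 \<le> S" using x[of 0] qnorm_nonneg[of "x 0"] by linarith
  have w_nonneg: "w K \<ge> 0" if "(\<xi>, K) \<in> p" for \<xi> K
    using seg_mono[of "Inf K" "Sup K" j] K(2,3)[OF that] by (simp add: w_def)
  have w_le: "w K \<le> len j" for K
    unfolding w_def by (rule seg_diff_le_len)
  have w_pos: "Inf K < t j \<and> t (Suc j) < Sup K" if "(\<xi>, K) \<in> p" "w K \<noteq> 0" for \<xi> K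
    using seg_diff_pos[of j "Inf K" "Sup K"] w_nonneg[OF that(1)] that(2) by (simp add: w_def)
  have qT: "q (sum ?g T) \<le> 2 * (len j * S)"
  proof -
    \<comment> \<open>All values on \<open>T\<close> are multiples of the one vector
      \<open>x j\<close>. The sum collapses to a scalar multiple, and no power of
      \<open>\<kappa>\<close> depending on the number of cells arises.\<close>
    have "sum ?g T = (\<Sum>(\<xi>, K)\<in>T. w K * bump j \<xi>) *\<^sub>R x j"
      unfolding scaleR_sum_left by (rule sum.cong) (auto simp: T_def glue_interval)
    moreover have "(\<Sum>(\<xi>, K)\<in>T. w K * bump j \<xi>) \<ge> 0"
      using w_nonneg bump_nonneg by (intro sum_nonneg) (auto simp: T_def)
    ultimately have eq: "q (sum ?g T) = (\<Sum>(\<xi>, K)\<in>T. w K * bump j \<xi>) * q (x j)"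
      by (simp add: qnorm_scaleR)
    have "(\<Sum>(\<xi>, K)\<in>T. w K * bump j \<xi>) \<le> (\<Sum>(\<xi>, K)\<in>T. w K * 2)"
      using w_nonneg bump_le_2 by (intro sum_mono) (auto simp: T_def intro!: mult_left_mono)
    also have "\<dots> \<le> (\<Sum>(\<xi>, K)\<in>p. w K * 2)"
      using w_nonneg by (intro sum_mono2 fin) (auto simp: T_def)
    also have "\<dots> = 2 * (\<Sum>(\<xi>, K)\<in>p. seg j (Sup K) - seg j (Inf K))"
      by (simp add: sum_distrib_left w_def case_prod_unfold mult.commute)
    also have "\<dots> = 2 * (seg j b - seg j a)"
      using additive_tagged_division_1[OF \<open>a \<le> b\<close> p, of "seg j"] by simp
    also have "\<dots> \<le> 2 * len j"
      using seg_diff_le_len[of j b a] by simp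
    finally have "(\<Sum>(\<xi>, K)\<in>T. w K * bump j \<xi>) * q (x j) \<le> 2 * len j * S"
      using len_pos[of j] by (intro mult_mono x) auto
    then show ?thesis using eq by simp
  qed
  have single: "q (sum ?g A) \<le> 2 * (len j * S)"
    if "A \<subseteq> p" and eq: "\<And>z z'. z \<in> A \<Longrightarrow> z' \<in> A \<Longrightarrow> z = z'" for A
  proof (cases "A = {}")
    case True
    then show ?thesis using S len_pos[of j] by (simp add: qnorm_zero)
  next
    case False
    then obtain \<xi> K where "(\<xi>, K) \<in> A" by auto
    then have A: "A = {(\<xi>, K)}"
      by (intro equalityI subsetI singletonI) (auto dest: eq)
    then have "q (sum ?g A) = w K * q (glue x \<xi>)"
      using w_nonneg that(1) by (simp add: qnorm_scaleR)
    also have "\<dots> \<le> len j * (2 * S)"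
      using len_pos[of j] by (intro mult_mono w_le qnorm_glue_le x) auto
    finally show ?thesis by simp
  qed
  have qU: "q (sum ?g U) \<le> 2 * (len j * S)"
  proof (rule single)
    fix z z' assume z: "z \<in> U" "z' \<in> U"
    obtain \<xi> K \<eta> L where zz: "z = (\<xi>, K)" "z' = (\<eta>, L)" by (metis surj_pair)
    have 1: "(\<xi>, K) \<in> p" "(\<eta>, L) \<in> p" "w K \<noteq> 0" "w L \<noteq> 0" "t j \<le> \<xi>" "t j \<le> \<eta>"
      using z zz by (auto simp: U_def)
    \<comment> \<open>Both cells begin to the left of \<open>t j\<close> and reach it, because their
      tags do; hence they overlap just left of \<open>t j\<close>.\<close>
    then have "max (Inf K) (Inf L) < min (Sup K) (Sup L)"
      using w_pos[OF 1(1,3)] w_pos[OF 1(2,4)] K(3)[OF 1(1)] K(3)[OF 1(2)] by auto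
    then show "z = z'" using tagged_division_of_overlap[OF p 1(1,2)] zz by blast
  qed (auto simp: U_def)
  have qV: "q (sum ?g V) \<le> 2 * (len j * S)"
  proof (rule single)
    fix z z' assume z: "z \<in> V" "z' \<in> V"
    obtain \<xi> K \<eta> L where zz: "z = (\<xi>, K)" "z' = (\<eta>, L)" by (metis surj_pair)
    have 1: "(\<xi>, K) \<in> p" "(\<eta>, L) \<in> p" "w K \<noteq> 0" "w L \<noteq> 0" "\<xi> \<le> t (Suc j)" "\<eta> \<le> t (Suc j)"
      using z zz by (auto simp: V_def)
    then have "max (Inf K) (Inf L) < min (Sup K) (Sup L)"
      using w_pos[OF 1(1,3)] w_pos[OF 1(2,4)] K(2)[OF 1(1)] K(2)[OF 1(2)] by auto
    then show "z = z'" using tagged_division_of_overlap[OF p 1(1,2)] zz by blast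
  qed (auto simp: V_def)
  have finTUV: "finite T" "finite U" "finite V"
    using fin by (auto simp: T_def U_def V_def intro: finite_subset[OF _ fin])
  have "sum ?g p = sum ?g (T \<union> (U \<union> V))"
    by (rule sum.mono_neutral_right[OF fin]) (auto simp: T_def U_def V_def)
  also have "\<dots> = sum ?g T + sum ?g (U \<union> V)"
    using finTUV by (intro sum.union_disjoint) (auto simp: T_def U_def V_def)
  also have "sum ?g (U \<union> V) = sum ?g U + sum ?g V"
    using finTUV t_Suc_less[of j] by (intro sum.union_disjoint) (auto simp: U_def V_def)
  finally have "q (sum ?g p) \<le> \<kappa> * (q (sum ?g T) + q (sum ?g U + sum ?g V))"
    using quasi_triangle by simp
  also have "\<dots> \<le> \<kappa> * (2 * (len j * S) + \<kappa> * (2 * (len j * S) + 2 * (len j * S)))"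
    using \<kappa>_pos by (intro mult_left_mono add_mono qT order_trans[OF quasi_triangle] qU qV) auto
  also have "\<dots> = (2 * \<kappa> + 4 * \<kappa>\<^sup>2) * (len j * S)"
    by (simp add: algebra_simps power2_eq_square)
  also have "\<dots> \<le> 6 * \<kappa>\<^sup>2 * (len j * S)"
    using \<kappa>_ge_1 S len_pos[of j] by (intro mult_right_mono) (auto simp: power2_eq_square)
  finally show ?thesis by (simp add: w_def case_prod_unfold)
qed

definition riemann_const :: real where
  "riemann_const = 6 * \<kappa> ^ 3 * (\<Sum>j. \<kappa> ^ Suc j * len j)"

lemma riemann_const_nonneg: "riemann_const \<ge> 0"
  unfolding riemann_const_def
  using \<kappa>_pos less_imp_le[OF len_pos] by (intro mult_nonneg_nonneg suminf_nonneg summable_len) auto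

text \<open>Cutting every cell along the partition turns the Riemann sum into a series of segment
  sums, the \<open>j\<close>-th of size at most a constant times \<open>len j * S\<close>. The
  weights \<open>\<kappa> ^ Suc j\<close> of \<open>qnorm_sum_le\<close> leave it convergent by
  \<open>summable_len\<close>, so the bound is the same for all tagged divisions.\<close>

lemma qnorm_riemann_sum_glue_le:
  assumes p: "p tagged_division_of {a..b}" and ab: "0 \<le> a" "a \<le> b" "b \<le> 1"
    and x: "\<And>j. q (x j) \<le> S"
  shows "q (\<Sum>(\<xi>, K)\<in>p. measure lborel K *\<^sub>R glue x \<xi>) \<le> riemann_const * S"
proof -
  define R where "R j = (\<Sum>(\<xi>, K)\<in>p. (seg j (Sup K) - seg j (Inf K)) *\<^sub>R glue x \<xi>)" for j
  define r where "r n K = min (Sup K) (t n) - min (Inf K) (t n)" for n and K :: "real set"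
  define rest where "rest n = (\<Sum>z\<in>p. r n (snd z) *\<^sub>R glue x (fst z))" for n
  note K = tagged_division_of_interval[OF p]
  have fin: "finite p" using p by blast
  have S: "0 \<le> S" using x[of 0] qnorm_nonneg[of "x 0"] by linarith
  have split: "(\<Sum>(\<xi>, K)\<in>p. measure lborel K *\<^sub>R glue x \<xi>) = (\<Sum>j<n. R j) + rest n" for n
  proof -
    have "(\<Sum>j<n. R j) = (\<Sum>(\<xi>, K)\<in>p. (\<Sum>j<n. seg j (Sup K) - seg j (Inf K)) *\<^sub>R glue x \<xi>)"
      unfolding R_def by (subst sum.swap) (simp add: case_prod_unfold scaleR_sum_left)
    also have "\<dots> + rest n = (\<Sum>(\<xi>, K)\<in>p. ((\<Sum>j<n. seg j (Sup K) - seg j (Inf K)) + r n K) *\<^sub>R glue x \<xi>)"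
      by (simp add: rest_def case_prod_unfold sum.distrib scaleR_add_left)
    also have "\<dots> = (\<Sum>(\<xi>, K)\<in>p. measure lborel K *\<^sub>R glue x \<xi>)"
    proof (rule sum.cong, rule refl, clarify)
      fix \<xi> K assume xK: "(\<xi>, K) \<in> p"
      then have "Sup K \<le> 1" "Inf K \<le> 1" using K(2-5)[OF xK] ab by auto
      then have "(\<Sum>j<n. seg j (Sup K) - seg j (Inf K)) + r n K = measure lborel K"
        using K(6)[OF xK] by (simp add: sum_subtractf sum_seg r_def)
      then show "((\<Sum>j<n. seg j (Sup K) - seg j (Inf K)) + r n K) *\<^sub>R glue x \<xi> = measure lborel K *\<^sub>R glue x \<xi>"
        by simp
    qed
    finally show ?thesis by simp
  qed
  have R: "q (\<Sum>j<n. R j) \<le> 6 * \<kappa>\<^sup>2 * (\<Sum>j. \<kappa> ^ Suc j * len j) * S" for n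
  proof -
    have "q (\<Sum>j<n. R j) \<le> (\<Sum>j<n. \<kappa> ^ Suc j * q (R j))"
      by (rule qnorm_sum_le)
    also have "\<dots> \<le> (\<Sum>j<n. \<kappa> ^ Suc j * (6 * \<kappa>\<^sup>2 * (len j * S)))"
      unfolding R_def using \<kappa>_pos
      by (intro sum_mono mult_left_mono qnorm_segment_sum_le[OF p ab(2) x]) auto
    also have "\<dots> = 6 * \<kappa>\<^sup>2 * S * (\<Sum>j<n. \<kappa> ^ Suc j * len j)"
      by (simp add: sum_distrib_left mult_ac)
    also have "\<dots> \<le> 6 * \<kappa>\<^sup>2 * S * (\<Sum>j. \<kappa> ^ Suc j * len j)"
      using S \<kappa>_pos less_imp_le[OF len_pos]
      by (intro mult_left_mono sum_le_suminf summable_len) auto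
    finally show ?thesis by (simp add: mult_ac)
  qed
  \<comment> \<open>For the fixed division \<open>p\<close>, the remainder combines finitely many
    fixed vectors with coefficients between 0 and \<open>t n\<close>.\<close>
  have "(\<lambda>n. q (rest n)) \<longlonglongrightarrow> 0"
    unfolding rest_def
  proof (rule tendsto_qnorm_sum_zero[OF fin])
    fix z assume "z \<in> p"
    moreover obtain \<xi> K where z: "z = (\<xi>, K)" by fastforce
    ultimately have xK: "(\<xi>, K) \<in> p" by simp
    have "0 \<le> Inf K" "Inf K \<le> Sup K" using K(2-5)[OF xK] ab by auto
    then have b: "0 \<le> r n K" "r n K \<le> t n" for n
      using t_pos[of n] by (auto simp: r_def)
    show "(\<lambda>n. r n (snd z)) \<longlonglongrightarrow> 0"
      by (rule tendsto_sandwich[OF _ _ tendsto_const t_tendsto]) (auto simp: z b)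
  qed
  then have lim: "(\<lambda>n. \<kappa> * (6 * \<kappa>\<^sup>2 * (\<Sum>j. \<kappa> ^ Suc j * len j) * S + q (rest n)))
      \<longlonglongrightarrow> \<kappa> * (6 * \<kappa>\<^sup>2 * (\<Sum>j. \<kappa> ^ Suc j * len j) * S + 0)"
    by (intro tendsto_intros)
  have "q (\<Sum>(\<xi>, K)\<in>p. measure lborel K *\<^sub>R glue x \<xi>)
      \<le> \<kappa> * (6 * \<kappa>\<^sup>2 * (\<Sum>j. \<kappa> ^ Suc j * len j) * S + 0)"
  proof (rule LIMSEQ_le_const[OF lim], intro exI allI impI)
    fix n
    have "q ((\<Sum>j<n. R j) + rest n) \<le> \<kappa> * (q (\<Sum>j<n. R j) + q (rest n))"
      by (rule quasi_triangle)
    also have "\<dots> \<le> \<kappa> * (6 * \<kappa>\<^sup>2 * (\<Sum>j. \<kappa> ^ Suc j * len j) * S + q (rest n))"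
      using \<kappa>_pos by (intro mult_left_mono add_right_mono R) auto
    finally show "q (\<Sum>(\<xi>, K)\<in>p. measure lborel K *\<^sub>R glue x \<xi>)
        \<le> \<kappa> * (6 * \<kappa>\<^sup>2 * (\<Sum>j. \<kappa> ^ Suc j * len j) * S + q (rest n))"
      by (simp only: split[of n])
  qed
  then show ?thesis
    by (simp add: riemann_const_def power2_eq_square power3_eq_cube mult_ac)
qed

section \<open>Integrability of the glued function\<close>

definition coef_sum :: "(nat \<Rightarrow> 'a) \<Rightarrow> real \<Rightarrow> real \<Rightarrow> nat \<Rightarrow> 'a" where
  "coef_sum x a b m = (\<Sum>j<m. coef a b j *\<^sub>R x j)"

lemma has_riemann_integral_bump_sum:
  assumes "a \<le> b"
  shows "has_riemann_integral q (\<lambda>s. \<Sum>j<m. bump j s *\<^sub>R x j) (coef_sum x a b m) a b"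
  unfolding has_riemann_integral_def limitin_quasi_norm_topology
proof (intro allI impI)
  fix e :: real assume "e > 0"
  define \<sigma> where "\<sigma> p j = (\<Sum>(\<xi>, K)\<in>p. measure lborel K * bump j \<xi>) - coef a b j"
    for p :: "(real \<times> real set) set" and j
  have "((\<lambda>p. \<sigma> p j) \<longlongrightarrow> 0) (mesh_filter a b)" for j
    unfolding \<sigma>_def coef_def using assms
    by (intro LIM_zero riemann_sums_tendsto_integral continuous_on_bump)
  then have "((\<lambda>p. q (\<Sum>j<m. \<sigma> p j *\<^sub>R x j)) \<longlongrightarrow> 0) (mesh_filter a b)"
    by (intro tendsto_qnorm_sum_zero) auto
  then have "eventually (\<lambda>p. q (\<Sum>j<m. \<sigma> p j *\<^sub>R x j) < e) (mesh_filter a b)"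
    using \<open>e > 0\<close> order_tendstoD(2) by blast
  moreover have "(\<Sum>(\<xi>, K)\<in>p. measure lborel K *\<^sub>R (\<Sum>j<m. bump j \<xi> *\<^sub>R x j)) - coef_sum x a b m
      = (\<Sum>j<m. \<sigma> p j *\<^sub>R x j)" for p
  proof -
    have "(\<Sum>(\<xi>, K)\<in>p. measure lborel K *\<^sub>R (\<Sum>j<m. bump j \<xi> *\<^sub>R x j))
        = (\<Sum>j<m. (\<Sum>(\<xi>, K)\<in>p. measure lborel K * bump j \<xi>) *\<^sub>R x j)"
      by (simp add: case_prod_unfold scaleR_sum_right scaleR_sum_left) (rule sum.swap)
    then show ?thesis
      by (simp add: \<sigma>_def coef_sum_def scaleR_diff_left sum_subtractf)
  qed
  ultimately show "eventually (\<lambda>p. q ((\<Sum>(\<xi>, K)\<in>p. measure lborel K *\<^sub>R (\<Sum>j<m. bump j \<xi> *\<^sub>R x j))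
      - coef_sum x a b m) < e) (mesh_filter a b)"
    by simp
qed

lemma coef_sum_tail_le:
  assumes "m \<le> n" and x: "\<And>j. j \<ge> m \<Longrightarrow> q (x j) \<le> e" and "e \<ge> 0"
  shows "q (coef_sum x a b n - coef_sum x a b m) \<le> (\<Sum>j. \<kappa> ^ Suc j * len j) * e"
proof -
  \<comment> \<open>Padding with zeros keeps the original indices, so that the weights of
    \<open>qnorm_sum_le\<close> match those in \<open>summable_len\<close>.\<close>
  define z where "z j = (if j < m then 0 else coef a b j *\<^sub>R x j)" for j
  have "coef_sum x a b n = (\<Sum>j<n. (if j < m then coef a b j *\<^sub>R x j else 0) + z j)"
    unfolding coef_sum_def by (rule sum.cong) (auto simp: z_def)
  moreover have "(\<Sum>j<n. if j < m then coef a b j *\<^sub>R x j else 0) = coef_sum x a b m"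
    unfolding coef_sum_def using \<open>m \<le> n\<close> by (intro sum.mono_neutral_cong_right) auto
  ultimately have "coef_sum x a b n - coef_sum x a b m = (\<Sum>j<n. z j)"
    by (simp add: sum.distrib)
  then have "q (coef_sum x a b n - coef_sum x a b m) \<le> (\<Sum>j<n. \<kappa> ^ Suc j * q (z j))"
    using qnorm_sum_le by metis
  also have "\<dots> \<le> (\<Sum>j<n. \<kappa> ^ Suc j * (len j * e))"
  proof (rule sum_mono, rule mult_left_mono)
    fix j
    show "q (z j) \<le> len j * e"
      using len_pos[of j] \<open>e \<ge> 0\<close> coef_nonneg[of a b j] x[of j]
      by (auto simp: z_def qnorm_zero qnorm_scaleR intro!: mult_mono coef_le_len)
  qed (use \<kappa>_pos in auto)
  also have "\<dots> = (\<Sum>j<n. \<kappa> ^ Suc j * len j) * e"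
    by (simp add: sum_distrib_right mult.assoc)
  also have "\<dots> \<le> (\<Sum>j. \<kappa> ^ Suc j * len j) * e"
    using \<kappa>_pos less_imp_le[OF len_pos] \<open>e \<ge> 0\<close>
    by (intro mult_right_mono sum_le_suminf summable_len) auto
  finally show ?thesis .
qed

lemma coef_sum_converges:
  assumes x: "(\<lambda>j. q (x j)) \<longlonglongrightarrow> 0"
  obtains L where "limitin (quasi_norm_topology q) (coef_sum x a b) L sequentially"
proof -
  let ?D = "\<Sum>j. \<kappa> ^ Suc j * len j"
  have D: "?D \<ge> 0"
    using \<kappa>_pos less_imp_le[OF len_pos] by (intro suminf_nonneg summable_len) auto
  have "\<exists>L. limitin (quasi_norm_topology q) (coef_sum x a b) L sequentially"
  \<comment> \<open>Completeness enters here: the tail estimate makes the partial sums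
    Cauchy.\<close>
  proof (rule qnorm_complete, intro allI impI)
    fix e :: real assume "e > 0"
    define e' where "e' = e / (?D + 1)"
    have e': "e' > 0" "?D * e' < e"
      using \<open>e > 0\<close> D by (auto simp: e'_def divide_simps)
    obtain M where M: "\<And>j. j \<ge> M \<Longrightarrow> q (x j) \<le> e'"
      using order_tendstoD(2)[OF x e'(1)] unfolding eventually_sequentially by (meson less_imp_le)
    have le: "q (coef_sum x a b n - coef_sum x a b m) < e" if "M \<le> m" "m \<le> n" for m n
      using coef_sum_tail_le[OF that(2), of x e' a b] M that e' by fastforce
    have "q (coef_sum x a b m - coef_sum x a b n) < e" if "M \<le> m" "M \<le> n" for m n
      using le[of m n] le[of n m] that qnorm_minus[of "coef_sum x a b m - coef_sum x a b n"]
      by (cases m n rule: le_cases) auto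
    then show "\<exists>M. \<forall>m\<ge>M. \<forall>n\<ge>M. q (coef_sum x a b m - coef_sum x a b n) < e" by blast
  qed
  then show thesis using that by blast
qed

text \<open>A three-term estimate: for a suitable \<open>m\<close>, the finite head has Riemann sums
  close to \<open>coef_sum x a b m\<close>, this is close to \<open>L\<close>, and the tail has
  small Riemann sums for every tagged division by \<open>qnorm_riemann_sum_glue_le\<close>.\<close>

lemma has_riemann_integral_glue:
  assumes x: "(\<lambda>j. q (x j)) \<longlonglongrightarrow> 0" and ab: "0 \<le> a" "a \<le> b" "b \<le> 1"
    and L: "limitin (quasi_norm_topology q) (coef_sum x a b) L sequentially"
  shows "has_riemann_integral q (glue x) L a b"
  unfolding has_riemann_integral_def limitin_quasi_norm_topology
proof (intro allI impI)
  fix e :: real assume "e > 0"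
  \<comment> \<open>Two quasi-triangle inequalities applied to three terms below \<open>e1\<close>
    give at most \<open>\<kappa> * (e1 + \<kappa> * (e1 + e1))\<close>, and this is at most
    \<open>3 * \<kappa>\<^sup>2 * e1 = e\<close>.\<close>
  define e1 where "e1 = e / (3 * \<kappa>\<^sup>2)"
  have e1: "e1 > 0" using \<open>e > 0\<close> \<kappa>_pos by (simp add: e1_def)
  define e2 where "e2 = e1 / (riemann_const + 1)"
  have e2: "e2 > 0" "riemann_const * e2 < e1"
    using e1 riemann_const_nonneg by (auto simp: e2_def divide_simps)
  have "eventually (\<lambda>j. q (x j) < e2) sequentially"
    using order_tendstoD(2)[OF x e2(1)] .
  moreover have "eventually (\<lambda>m. q (coef_sum x a b m - L) < e1) sequentially"
    using L e1 by (simp add: limitin_quasi_norm_topology)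
  ultimately obtain M N where "\<And>j. j \<ge> M \<Longrightarrow> q (x j) < e2" "\<And>m. m \<ge> N \<Longrightarrow> q (coef_sum x a b m - L) < e1"
    unfolding eventually_sequentially by blast
  then obtain m where m: "\<And>j. j \<ge> m \<Longrightarrow> q (x j) < e2" "q (coef_sum x a b m - L) < e1"
    using that[of "max M N"] by simp
  let ?S = "\<lambda>f p. \<Sum>(\<xi>, K)\<in>p. measure lborel K *\<^sub>R f \<xi>"
  let ?f = "\<lambda>s. \<Sum>j<m. bump j s *\<^sub>R x j"
  let ?y = "\<lambda>j. if j < m then 0 else x j"
  have "eventually (\<lambda>p. q (?S ?f p - coef_sum x a b m) < e1) (mesh_filter a b)"
    using has_riemann_integral_bump_sum[OF ab(2), where m = m and x = x] e1
    by (simp add: has_riemann_integral_def limitin_quasi_norm_topology)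
  moreover have "eventually (\<lambda>p. p tagged_division_of {a..b}) (mesh_filter a b)"
    unfolding eventually_mesh_filter by (intro exI[of _ 1]) auto
  ultimately show "eventually (\<lambda>p. q (?S (glue x) p - L) < e) (mesh_filter a b)"
  proof eventually_elim
    case (elim p)
    have g: "q (?S (glue ?y) p) < e1"
    proof -
      have "q (?S (glue ?y) p) \<le> riemann_const * e2"
        by (rule qnorm_riemann_sum_glue_le[OF elim(2) ab])
          (use m(1) e2(1) in \<open>auto simp: qnorm_zero less_imp_le not_less\<close>)
      then show ?thesis using e2(2) by simp
    qed
    have "?S (glue x) p = ?S ?f p + ?S (glue ?y) p"
      by (subst glue_split[of x _ m]) (simp add: case_prod_unfold scaleR_add_right sum.distrib)
    then have "?S (glue x) p - L = ?S (glue ?y) p + ((?S ?f p - coef_sum x a b m) + (coef_sum x a b m - L))"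
      by simp
    then have "q (?S (glue x) p - L)
        \<le> \<kappa> * (q (?S (glue ?y) p) + q ((?S ?f p - coef_sum x a b m) + (coef_sum x a b m - L)))"
      by (simp only: quasi_triangle)
    also have "\<dots> \<le> \<kappa> * (q (?S (glue ?y) p) + \<kappa> * (q (?S ?f p - coef_sum x a b m) + q (coef_sum x a b m - L)))"
      using \<kappa>_pos by (intro mult_left_mono add_left_mono quasi_triangle) auto
    also have "\<dots> < \<kappa> * (e1 + \<kappa> * (e1 + e1))"
      using \<kappa>_pos g elim(1) m(2) by (intro mult_strict_left_mono add_strict_mono) auto
    also have "\<dots> \<le> 3 * \<kappa>\<^sup>2 * e1"
    proof -
      have "\<kappa> * e1 \<le> \<kappa>\<^sup>2 * e1"
        using \<kappa>_ge_1 e1 by (intro mult_right_mono) (auto simp: power2_eq_square)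
      then show ?thesis by (simp add: power2_eq_square algebra_simps)
    qed
    also have "\<dots> = e" using \<kappa>_pos by (simp add: e1_def)
    finally show ?case .
  qed
qed

text \<open>The finite head is continuous because its scalar coefficients are, and the tail is
  uniformly small because the bumps are bounded by 2 and the vectors tend to 0.\<close>

lemma continuous_map_glue:
  assumes x: "(\<lambda>j. q (x j)) \<longlonglongrightarrow> 0"
  shows "continuous_map (top_of_set A) (quasi_norm_topology q) (glue x)"
proof -
  have lim: "eventually (\<lambda>s. q (glue x s - glue x s0) < e) (nhds s0)" if "e > 0" for s0 e :: real
  proof -
    define e1 where "e1 = e / (3 * \<kappa>\<^sup>2)"
    have e1: "e1 > 0" using \<open>e > 0\<close> \<kappa>_pos by (simp add: e1_def)
    define e2 where "e2 = e1 / 3"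
    have e2: "e2 > 0" "2 * e2 < e1" using e1 by (auto simp: e2_def)
    obtain m where m: "\<And>j. j \<ge> m \<Longrightarrow> q (x j) < e2"
      using order_tendstoD(2)[OF x e2(1)] unfolding eventually_sequentially by blast
    let ?f = "\<lambda>s. \<Sum>j<m. bump j s *\<^sub>R x j"
    let ?y = "\<lambda>j. if j < m then 0 else x j"
    have small: "q (glue ?y s) < e1" for s
    proof -
      have "q (glue ?y s) \<le> 2 * e2"
        by (rule qnorm_glue_le) (use m e2(1) in \<open>auto simp: qnorm_zero less_imp_le not_less\<close>)
      then show ?thesis using e2(2) by simp
    qed
    have "((\<lambda>s. bump j s - bump j s0) \<longlongrightarrow> 0) (nhds s0)" for j
    proof -
      have "isCont (bump j) s0"
        using continuous_on_bump[of UNIV j] by (simp add: continuous_on_eq_continuous_at)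
      then have "(bump j \<longlongrightarrow> bump j s0) (nhds s0)"
        by (simp add: isCont_def tendsto_at_iff_tendsto_nhds)
      then show ?thesis by (rule LIM_zero)
    qed
    then have "((\<lambda>s. q (\<Sum>j<m. (bump j s - bump j s0) *\<^sub>R x j)) \<longlongrightarrow> 0) (nhds s0)"
      by (intro tendsto_qnorm_sum_zero) auto
    then have "eventually (\<lambda>s. q (\<Sum>j<m. (bump j s - bump j s0) *\<^sub>R x j) < e1) (nhds s0)"
      using e1 order_tendstoD(2) by blast
    then show ?thesis
    proof eventually_elim
      case (elim s)
      have "glue x s - glue x s0 = glue ?y s + ((?f s - ?f s0) + - glue ?y s0)"
        using glue_split[of x s m] glue_split[of x s0 m] by simp
      then have "q (glue x s - glue x s0) \<le> \<kappa> * (q (glue ?y s) + q ((?f s - ?f s0) + - glue ?y s0))"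
        by (simp only: quasi_triangle)
      also have "\<dots> \<le> \<kappa> * (q (glue ?y s) + \<kappa> * (q (?f s - ?f s0) + q (- glue ?y s0)))"
        using \<kappa>_pos by (intro mult_left_mono add_left_mono quasi_triangle) auto
      also have "\<dots> < \<kappa> * (e1 + \<kappa> * (e1 + e1))"
        using \<kappa>_pos elim small[of s] small[of s0]
        by (intro mult_strict_left_mono add_strict_mono)
          (auto simp: qnorm_minus scaleR_diff_left sum_subtractf)
      also have "\<dots> \<le> 3 * \<kappa>\<^sup>2 * e1"
      proof -
        have "\<kappa> * e1 \<le> \<kappa>\<^sup>2 * e1"
          using \<kappa>_ge_1 e1 by (intro mult_right_mono) (auto simp: power2_eq_square)
        then show ?thesis by (simp add: power2_eq_square algebra_simps)
      qed
      also have "\<dots> = e" using \<kappa>_pos by (simp add: e1_def)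
      finally show ?case .
    qed
  qed
  have "openin (top_of_set A) {s \<in> A. glue x s \<in> U}" if U: "openin (quasi_norm_topology q) U" for U
    unfolding openin_euclidean_subtopology_iff
  proof (intro conjI ballI)
    fix s0 assume "s0 \<in> {s \<in> A. glue x s \<in> U}"
    then obtain e where e: "e > 0" "\<And>y. q (y - glue x s0) < e \<Longrightarrow> y \<in> U"
      using U unfolding openin_quasi_norm_topology by blast
    then obtain d where "d > 0" "\<And>s. dist s s0 < d \<Longrightarrow> q (glue x s - glue x s0) < e"
      using lim[of e s0] unfolding eventually_nhds_metric by blast
    then show "\<exists>d>0. \<forall>s\<in>A. dist s s0 < d \<longrightarrow> s \<in> {s \<in> A. glue x s \<in> U}"
      using e(2) by blast
  qed auto
  then show ?thesis by (simp add: continuous_map_def)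
qed

end

section \<open>Averages of block series\<close>

lemma strict_mono_block:
  fixes n :: "nat \<Rightarrow> nat"
  assumes "strict_mono n" "n 0 = 0"
  obtains k where "n k \<le> u" "u < n (Suc k)"
proof -
  have ex: "u < n (Suc u)"
    using strict_mono_imp_increasing[OF assms(1), of "Suc u"] by simp
  define k where "k = (LEAST k. u < n (Suc k))"
  have "u < n (Suc k)" unfolding k_def by (rule LeastI) (rule ex)
  moreover have "n k \<le> u"
  proof (cases k)
    case (Suc i)
    then show ?thesis
      using not_less_Least[of i "\<lambda>k. u < n (Suc k)"] by (simp add: k_def[symmetric])
  qed (simp add: assms)
  ultimately show thesis using that by blast
qed

text \<open>The indices in \<open>{n k..<n (Suc k)}\<close> form a block on which the averages of \<open>x\<close>, weighted by the
  lengths, have quasi-norm at most 1, with equality for the whole block.\<close>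

locale block_series = bump_series q \<kappa> t
  for q :: "'a::real_vector \<Rightarrow> real" and \<kappa> :: real and t :: "nat \<Rightarrow> real" +
  fixes x :: "nat \<Rightarrow> 'a" and n :: "nat \<Rightarrow> nat"
  assumes qnorm_x_le_1: "q (x j) \<le> 1"
    and qnorm_x_tendsto: "(\<lambda>j. q (x j)) \<longlonglongrightarrow> 0"
    and strict_mono_n: "strict_mono n"
    and n_0: "n 0 = 0"
    and block_part: "\<lbrakk>n k \<le> u; u \<le> v; v \<le> n (Suc k)\<rbrakk> \<Longrightarrow> q (\<Sum>j\<in>{u..<v}. len j *\<^sub>R x j) \<le> t u - t v"
    and block_full: "q (\<Sum>j\<in>{n k..<n (Suc k)}. len j *\<^sub>R x j) = t (n k) - t (n (Suc k))"
    and block_decay: "4 * \<kappa>\<^sup>2 * t (n (Suc k)) \<le> t (n k) - t (n (Suc k))"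
begin

section \<open>Bounds for contiguous sums\<close>

lemma qnorm_sum_split_le:
  assumes "u \<le> w" "w \<le> v"
  shows "q (\<Sum>j\<in>{u..<v}. len j *\<^sub>R x j)
    \<le> \<kappa> * (q (\<Sum>j\<in>{u..<w}. len j *\<^sub>R x j) + q (\<Sum>j\<in>{w..<v}. len j *\<^sub>R x j))"
  by (subst sum.atLeastLessThan_concat[OF assms, symmetric]) (rule quasi_triangle)

lemma block_decay': "2 * \<kappa> * t (n (Suc k)) \<le> t (n k) - t (n (Suc k))"
proof -
  have "2 * \<kappa> * t (n (Suc k)) \<le> 4 * \<kappa>\<^sup>2 * t (n (Suc k))"
    using \<kappa>_ge_1 less_imp_le[OF t_pos] by (intro mult_right_mono) (auto simp: power2_eq_square)
  then show ?thesis using block_decay[of k] by linarith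
qed

text \<open>The induction does not accumulate factors of \<open>\<kappa>\<close>: the bound for
  everything after the first block is, by \<open>block_decay'\<close>, already at most the length of
  that block, so one quasi-triangle inequality restores the constant
  \<open>2 * \<kappa>\<close>.\<close>

lemma qnorm_block_tail_le:
  assumes "n k \<le> v"
  shows "q (\<Sum>j\<in>{n k..<v}. len j *\<^sub>R x j) \<le> 2 * \<kappa> * (t (n k) - t v)"
proof -
  \<comment> \<open>Induction on the number \<open>r\<close> of blocks that may be met;
    \<open>k\<close> stays arbitrary since the step passes to \<open>Suc k\<close>.\<close>
  have "q (\<Sum>j\<in>{n k..<v}. len j *\<^sub>R x j) \<le> 2 * \<kappa> * (t (n k) - t v)"
    if "n k \<le> v" "v \<le> n (k + r)" for r
    using that
  proof (induction r arbitrary: k)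
    case 0
    then show ?case by (simp add: qnorm_zero)
  next
    case (Suc r)
    show ?case
    proof (cases "v \<le> n (Suc k)")
      case True
      have "t (n k) - t v \<le> 2 * \<kappa> * (t (n k) - t v)"
        using \<kappa>_ge_1 t_antimono[OF Suc.prems(1)] mult_right_mono[of 1 "2 * \<kappa>" "t (n k) - t v"] by simp
      then show ?thesis
        using block_part[of k "n k" v] Suc.prems(1) True by simp
    next
      case False
      have le: "n k \<le> n (Suc k)" "n (Suc k) \<le> v"
        using False strict_mono_n by (auto simp: strict_mono_less_eq)
      have "q (\<Sum>j\<in>{n (Suc k)..<v}. len j *\<^sub>R x j) \<le> 2 * \<kappa> * (t (n (Suc k)) - t v)"
        using Suc.IH[of "Suc k"] Suc.prems le by simp
      also have "\<dots> \<le> 2 * \<kappa> * t (n (Suc k))"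
        using \<kappa>_pos less_imp_le[OF t_pos] by (intro mult_left_mono) auto
      also have "\<dots> \<le> t (n k) - t (n (Suc k))" by (rule block_decay')
      finally have tail: "q (\<Sum>j\<in>{n (Suc k)..<v}. len j *\<^sub>R x j) \<le> t (n k) - t (n (Suc k))" .
      have "q (\<Sum>j\<in>{n k..<v}. len j *\<^sub>R x j)
          \<le> \<kappa> * ((t (n k) - t (n (Suc k))) + (t (n k) - t (n (Suc k))))"
        using \<kappa>_pos tail block_full[of k]
        by (intro order_trans[OF qnorm_sum_split_le[OF le]] mult_left_mono add_mono) auto
      also have "\<dots> \<le> \<kappa> * ((t (n k) - t v) + (t (n k) - t v))"
        using \<kappa>_pos t_antimono[OF le(2)] by (intro mult_left_mono add_mono) auto
      finally show ?thesis by (simp add: algebra_simps)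
    qed
  qed
  moreover have "v \<le> n (k + v)"
    using strict_mono_imp_increasing[OF strict_mono_n, of "k + v"] by simp
  ultimately show ?thesis using assms by blast
qed

text \<open>Cut at the end of the block containing \<open>u\<close>: the first part lies within one
  block, and the second starts at a block boundary.\<close>

lemma qnorm_contiguous_le:
  assumes "u \<le> v"
  shows "q (\<Sum>j\<in>{u..<v}. len j *\<^sub>R x j) \<le> 2 * \<kappa>\<^sup>2 * (t u - t v)"
proof -
  obtain k where k: "n k \<le> u" "u < n (Suc k)"
    using strict_mono_block[OF strict_mono_n n_0] .
  have tuv: "t v \<le> t u" by (rule t_antimono[OF assms])
  have \<kappa>2: "1 \<le> \<kappa>\<^sup>2"
    using \<kappa>_ge_1 by (rule one_le_power)
  show ?thesis
  proof (cases "v \<le> n (Suc k)")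
    case True
    have "t u - t v \<le> 2 * \<kappa>\<^sup>2 * (t u - t v)"
      using \<kappa>2 tuv mult_right_mono[of 1 "2 * \<kappa>\<^sup>2" "t u - t v"] by simp
    then show ?thesis
      using block_part[OF k(1) assms True] by simp
  next
    case False
    then have le: "u \<le> n (Suc k)" "n (Suc k) \<le> v" using k by auto
    have "q (\<Sum>j\<in>{u..<v}. len j *\<^sub>R x j) \<le> \<kappa> * ((t u - t (n (Suc k))) + 2 * \<kappa> * (t (n (Suc k)) - t v))"
      using \<kappa>_pos block_part[OF k(1) le(1)] qnorm_block_tail_le[OF le(2)]
      by (intro order_trans[OF qnorm_sum_split_le[OF le]] mult_left_mono add_mono) auto
    also have "\<dots> \<le> \<kappa> * (2 * \<kappa> * (t u - t (n (Suc k))) + 2 * \<kappa> * (t (n (Suc k)) - t v))"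
      using \<kappa>_ge_1 t_antimono[OF le(1)] mult_right_mono[of 1 "2 * \<kappa>" "t u - t (n (Suc k))"]
      by (intro mult_left_mono add_mono) auto
    also have "\<dots> = 2 * \<kappa>\<^sup>2 * (t u - t v)"
      by (simp add: power2_eq_square algebra_simps)
    finally show ?thesis .
  qed
qed

text \<open>Intervals strictly between the extreme ones meeting \<open>{a..b}\<close> are covered
  completely and form a contiguous sum. The extreme ones contribute at most
  \<open>2 * (b - a)\<close> each, as bumps are at most 2 and the vectors have quasi-norm at most
  1.\<close>

lemma qnorm_coef_sum_le:
  assumes ab: "0 \<le> a" "a < b" "b \<le> 1"
  shows "q (coef_sum x a b m) \<le> 8 * \<kappa> ^ 4 * (b - a)"
proof -
  define z where "z j = coef a b j *\<^sub>R x j" for j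
  have nonneg: "0 \<le> 8 * \<kappa> ^ 4 * (b - a)" using ab \<kappa>_pos by simp
  have \<kappa>4: "\<kappa> \<le> \<kappa> ^ 4" "\<kappa>\<^sup>2 \<le> \<kappa> ^ 4" "1 \<le> \<kappa> ^ 4"
    using \<kappa>_ge_1 power_increasing[of 1 4 \<kappa>] power_increasing[of 2 4 \<kappa>] power_increasing[of 0 4 \<kappa>] by auto
  have qz: "q (z j) \<le> 2 * (b - a)" for j
  proof -
    have "q (z j) = coef a b j * q (x j)"
      using coef_nonneg[of a b j] by (simp add: z_def qnorm_scaleR)
    also have "\<dots> \<le> 2 * (b - a) * 1"
      using ab by (intro mult_mono coef_le_length qnorm_x_le_1) auto
    finally show ?thesis by simp
  qed
  have "eventually (\<lambda>j. t j < b) sequentially"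
    using order_tendstoD(2)[OF t_tendsto] ab by auto
  then obtain j0 where "t (Suc j0) < b"
    unfolding eventually_sequentially by (meson le_SucI order_refl)
  \<comment> \<open>Since \<open>t\<close> decreases, \<open>u\<close> is the interval at the right
    end \<open>b\<close>; smaller indices have coefficient 0.\<close>
  define u where "u = (LEAST j. t (Suc j) < b)"
  have u: "t (Suc u) < b" unfolding u_def by (rule LeastI) fact
  have z_low: "z j = 0" if "j < u" for j
    using not_less_Least[of j "\<lambda>j. t (Suc j) < b"] that by (auto simp: u_def z_def coef_eq_0 not_less)
  show ?thesis
  proof (cases "\<exists>j. u \<le> j \<and> j < m \<and> a < t j")
    case False
    then have "z j = 0" if "j < m" for j
      using that z_low[of j] by (cases "j < u") (auto simp: z_def coef_eq_0 not_less)
    then have "coef_sum x a b m = 0"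
      unfolding coef_sum_def z_def[symmetric] by (intro sum.neutral) auto
    then show ?thesis using nonneg by (simp add: qnorm_zero)
  next
    case True
    \<comment> \<open>The last interval below \<open>m\<close> reaching beyond \<open>a\<close>; it
      exists even for \<open>a = 0\<close> because \<open>m\<close> bounds the indices.\<close>
    define w where "w = (GREATEST j. u \<le> j \<and> j < m \<and> a < t j)"
    have bounded: "\<And>j. u \<le> j \<and> j < m \<and> a < t j \<Longrightarrow> j \<le> m" by auto
    have w: "u \<le> w" "w < m" "a < t w"
      using GreatestI_ex_nat[OF True bounded] by (auto simp: w_def)
    have z_high: "z j = 0" if "w < j" "j < m" for j
    proof -
      have "\<not> a < t j"
      proof
        assume "a < t j"
        then have "j \<le> w" unfolding w_def
          using that w(1) by (intro Greatest_le_nat[of _ _ m]) auto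
        then show False using that by simp
      qed
      then show ?thesis by (auto simp: z_def coef_eq_0)
    qed
    have sum: "coef_sum x a b m = (\<Sum>j\<in>{u..w}. z j)"
      unfolding coef_sum_def z_def[symmetric] using w z_low z_high
      by (intro sum.mono_neutral_right) (auto simp: not_le)
    show ?thesis
    proof (cases "u = w")
      case True
      have "2 * (b - a) \<le> 8 * \<kappa> ^ 4 * (b - a)"
        using \<kappa>4 ab by (intro mult_right_mono) auto
      then show ?thesis using qz[of w] sum True by simp
    next
      case False
      then have uw: "Suc u \<le> w" using w by simp
      have mid: "z j = len j *\<^sub>R x j" if "j \<in> {Suc u..<w}" for j
      proof -
        have "t j \<le> t (Suc u)" "t w \<le> t (Suc j)"
          using that by (auto intro: t_antimono)
        then show ?thesis
          unfolding z_def using u w by (subst coef_eq_len) auto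
      qed
      have "{u..w} = insert u (insert w {Suc u..<w})" using uw by auto
      then have "coef_sum x a b m = z u + (z w + (\<Sum>j\<in>{Suc u..<w}. len j *\<^sub>R x j))"
        using uw mid by (simp add: sum)
      then have "q (coef_sum x a b m) \<le> \<kappa> * (q (z u) + q (z w + (\<Sum>j\<in>{Suc u..<w}. len j *\<^sub>R x j)))"
        by (simp only: quasi_triangle)
      also have "\<dots> \<le> \<kappa> * (q (z u) + \<kappa> * (q (z w) + q (\<Sum>j\<in>{Suc u..<w}. len j *\<^sub>R x j)))"
        using \<kappa>_pos by (intro mult_left_mono add_left_mono quasi_triangle) auto
      also have "\<dots> \<le> \<kappa> * (2 * (b - a) + \<kappa> * (2 * (b - a) + 2 * \<kappa>\<^sup>2 * (b - a)))"
      proof -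
        have "2 * \<kappa>\<^sup>2 * (t (Suc u) - t w) \<le> 2 * \<kappa>\<^sup>2 * (b - a)"
          using u w by (intro mult_left_mono) auto
        then have "q (\<Sum>j\<in>{Suc u..<w}. len j *\<^sub>R x j) \<le> 2 * \<kappa>\<^sup>2 * (b - a)"
          using qnorm_contiguous_le[OF uw] by simp
        then show ?thesis
          using \<kappa>_pos qz by (intro mult_left_mono add_mono) auto
      qed
      also have "\<dots> = (2 * \<kappa> + 2 * \<kappa>\<^sup>2 + 2 * \<kappa> ^ 4) * (b - a)"
        by (simp add: algebra_simps power2_eq_square power4_eq_xxxx)
      also have "\<dots> \<le> 8 * \<kappa> ^ 4 * (b - a)"
        using \<kappa>4 ab by (intro mult_right_mono) auto
      finally show ?thesis .
    qed
  qed
qed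

section \<open>Integrals and averages of the glued function\<close>

lemma glue_integral:
  assumes "0 \<le> a" "a \<le> b" "b \<le> 1"
  shows "has_riemann_integral q (glue x) (riemann_integral q (glue x) a b) a b"
    and "(\<lambda>m. q (coef_sum x a b m - riemann_integral q (glue x) a b)) \<longlonglongrightarrow> 0"
proof -
  obtain L where L: "limitin (quasi_norm_topology q) (coef_sum x a b) L sequentially"
    using coef_sum_converges[OF qnorm_x_tendsto] .
  have int: "has_riemann_integral q (glue x) L a b"
    by (rule has_riemann_integral_glue[OF qnorm_x_tendsto assms L])
  have eq: "riemann_integral q (glue x) a b = L"
    by (rule riemann_integral_unique[OF int assms(2)])
  show "has_riemann_integral q (glue x) (riemann_integral q (glue x) a b) a b"
    using int eq by simp
  have "eventually (\<lambda>m. q (coef_sum x a b m - L) < e) sequentially" if "e > 0" for e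
    using L that by (simp add: limitin_quasi_norm_topology)
  then show "(\<lambda>m. q (coef_sum x a b m - riemann_integral q (glue x) a b)) \<longlonglongrightarrow> 0"
    unfolding eq by (intro tendstoI) (auto simp: dist_real_def)
qed

text \<open>The bound for the partial sums survives the limit at the price of one more factor
  \<open>\<kappa>\<close>, as \<open>q\<close> need not be continuous.\<close>

lemma qnorm_integral_le:
  assumes "0 \<le> a" "a < b" "b \<le> 1"
  shows "q (riemann_integral q (glue x) a b) \<le> 8 * \<kappa> ^ 5 * (b - a)"
proof -
  let ?L = "riemann_integral q (glue x) a b" and ?P = "coef_sum x a b"
  have "(\<lambda>m. \<kappa> * (q (?P m - ?L) + 8 * \<kappa> ^ 4 * (b - a))) \<longlonglongrightarrow> \<kappa> * (0 + 8 * \<kappa> ^ 4 * (b - a))"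
    using assms by (intro tendsto_intros glue_integral) auto
  then have "q ?L \<le> \<kappa> * (0 + 8 * \<kappa> ^ 4 * (b - a))"
  proof (rule LIMSEQ_le_const, intro exI allI impI)
    fix m
    have "q ?L \<le> \<kappa> * (q (?L - ?P m) + q (?P m))"
      using quasi_triangle[of "?L - ?P m" "?P m"] by simp
    also have "\<dots> \<le> \<kappa> * (q (?P m - ?L) + 8 * \<kappa> ^ 4 * (b - a))"
      using \<kappa>_pos qnorm_coef_sum_le[OF assms] qnorm_minus[of "?P m - ?L"]
      by (intro mult_left_mono add_mono) auto
    finally show "q ?L \<le> \<kappa> * (q (?P m - ?L) + 8 * \<kappa> ^ 4 * (b - a))" .
  qed
  also have "\<dots> = 8 * \<kappa> ^ 5 * (b - a)"
    by (simp add: eval_nat_numeral)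
  finally show ?thesis .
qed

text \<open>The integral starts with a full block of quasi-norm \<open>d\<close>, its length. By
  \<open>block_decay\<close> the later blocks can cancel at most half of it in the quasi-triangle
  inequality, which leaves partial sums of quasi-norm at least \<open>d / (2 * \<kappa>)\<close>.
  The limit costs another \<open>\<kappa>\<close>, and \<open>t (n k) \<le> 2 * d\<close>.\<close>

lemma qnorm_integral_block_ge:
  "t (n k) \<le> 4 * \<kappa>\<^sup>2 * q (riemann_integral q (glue x) 0 (t (n k)))"
proof -
  let ?L = "riemann_integral q (glue x) 0 (t (n k))" and ?P = "coef_sum x 0 (t (n k))"
  define d where "d = t (n k) - t (n (Suc k))"
  have mono: "n k \<le> n (Suc k)" using strict_mono_n by (simp add: strict_mono_less_eq)
  have P_ge: "d \<le> 2 * \<kappa> * q (?P m)" if "n (Suc k) \<le> m" for m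
  proof -
    have "?P m = (\<Sum>j\<in>{n k..<m}. len j *\<^sub>R x j)"
      unfolding coef_sum_def
    proof (rule sum.mono_neutral_cong_right)
      show "\<forall>j\<in>{..<m} - {n k..<m}. coef 0 (t (n k)) j *\<^sub>R x j = 0"
        by (auto simp: coef_eq_0 t_antimono)
      show "coef 0 (t (n k)) j *\<^sub>R x j = len j *\<^sub>R x j" if "j \<in> {n k..<m}" for j
        using that t_antimono[of "n k" j] less_imp_le[OF t_pos[of "Suc j"]] by (simp add: coef_eq_len)
    qed auto
    also have "\<dots> = (\<Sum>j\<in>{n k..<n (Suc k)}. len j *\<^sub>R x j) + (\<Sum>j\<in>{n (Suc k)..<m}. len j *\<^sub>R x j)"
      using sum.atLeastLessThan_concat[OF mono that, of "\<lambda>j. len j *\<^sub>R x j"] by simp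
    finally have "(\<Sum>j\<in>{n k..<n (Suc k)}. len j *\<^sub>R x j) = ?P m + - (\<Sum>j\<in>{n (Suc k)..<m}. len j *\<^sub>R x j)"
      by simp
    then have "d \<le> \<kappa> * (q (?P m) + q (\<Sum>j\<in>{n (Suc k)..<m}. len j *\<^sub>R x j))"
      using quasi_triangle[of "?P m" "- (\<Sum>j\<in>{n (Suc k)..<m}. len j *\<^sub>R x j)"] block_full[of k]
      by (simp add: qnorm_minus d_def)
    also have "\<dots> \<le> \<kappa> * (q (?P m) + 2 * \<kappa> * t (n (Suc k)))"
    proof -
      have "2 * \<kappa> * (t (n (Suc k)) - t m) \<le> 2 * \<kappa> * t (n (Suc k))"
        using \<kappa>_pos less_imp_le[OF t_pos] by (intro mult_left_mono) auto
      then show ?thesis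
        using \<kappa>_pos
        by (intro mult_left_mono add_left_mono order_trans[OF qnorm_block_tail_le[OF that]]) auto
    qed
    also have "\<dots> = \<kappa> * q (?P m) + (4 * \<kappa>\<^sup>2 * t (n (Suc k))) / 2"
      by (simp add: power2_eq_square algebra_simps)
    also have "\<dots> \<le> \<kappa> * q (?P m) + d / 2"
      unfolding d_def by (intro add_left_mono divide_right_mono block_decay) simp
    finally show ?thesis by simp
  qed
  have "(\<lambda>m. 2 * \<kappa> * (\<kappa> * (q (?P m - ?L) + q ?L))) \<longlonglongrightarrow> 2 * \<kappa> * (\<kappa> * (0 + q ?L))"
    using t_le_1 less_imp_le[OF t_pos] by (intro tendsto_intros glue_integral) auto
  then have "d \<le> 2 * \<kappa> * (\<kappa> * (0 + q ?L))"
  proof (rule LIMSEQ_le_const, intro exI allI impI)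
    fix m assume m: "n (Suc k) \<le> m"
    have "q (?P m) \<le> \<kappa> * (q (?P m - ?L) + q ?L)"
      using quasi_triangle[of "?P m - ?L" ?L] by simp
    then have "2 * \<kappa> * q (?P m) \<le> 2 * \<kappa> * (\<kappa> * (q (?P m - ?L) + q ?L))"
      using \<kappa>_pos by (intro mult_left_mono) auto
    then show "d \<le> 2 * \<kappa> * (\<kappa> * (q (?P m - ?L) + q ?L))"
      using P_ge[OF m] by linarith
  qed
  moreover have "t (n k) \<le> 2 * d"
  proof -
    have "t (n (Suc k)) \<le> 2 * \<kappa> * t (n (Suc k))"
      using \<kappa>_ge_1 less_imp_le[OF t_pos] mult_right_mono[of 1 "2 * \<kappa>" "t (n (Suc k))"] by simp
    then show ?thesis using block_decay'[of k] by (simp add: d_def)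
  qed
  ultimately show ?thesis by (simp add: power2_eq_square)
qed

theorem bounded_not_separately_continuous:
  "continuous_map (top_of_set {0..1}) (quasi_norm_topology q) (glue x)"
  "riemann_integrable q (glue x) 0 1"
  "bounded_on_square q (Ave q (glue x))"
  "\<not> separately_continuous q (Ave q (glue x))"
proof -
  show "continuous_map (top_of_set {0..1}) (quasi_norm_topology q) (glue x)"
    by (rule continuous_map_glue[OF qnorm_x_tendsto])
  show "riemann_integrable q (glue x) 0 1"
    using glue_integral(1)[of 0 1] by (auto simp: riemann_integrable_def)
  \<comment> \<open>The added 2 lets the same constant cover the diagonal, where the average is a
    value of \<open>glue x\<close>.\<close>
  have avg: "q ((1 / (b - a)) *\<^sub>R riemann_integral q (glue x) a b) \<le> 8 * \<kappa> ^ 5 + 2"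
    if "0 \<le> a" "a < b" "b \<le> 1" for a b
    using qnorm_integral_le[OF that] that by (simp add: qnorm_scaleR divide_simps algebra_simps)
  have \<kappa>5: "\<kappa> ^ 5 \<ge> 0" using \<kappa>_pos by simp
  have "q (Ave q (glue x) a b) \<le> 8 * \<kappa> ^ 5 + 2" if "a \<in> {0..1}" "b \<in> {0..1}" for a b
  proof (cases a b rule: linorder_cases)
    case less
    then have "Ave q (glue x) a b = (1 / (b - a)) *\<^sub>R riemann_integral q (glue x) a b"
      unfolding Ave_def by (simp only: if_True)
    then show ?thesis using avg[of a b] less that by simp
  next
    case equal
    then have "q (Ave q (glue x) a b) \<le> 2"
      using qnorm_glue_le[of x 1 a] qnorm_x_le_1 by (simp add: Ave_def)
    then show ?thesis using \<kappa>5 by linarith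
  next
    case greater
    then have "Ave q (glue x) a b = (1 / (a - b)) *\<^sub>R riemann_integral q (glue x) b a"
      unfolding Ave_def by auto
    then show ?thesis using avg[of b a] greater that by simp
  qed
  then show "bounded_on_square q (Ave q (glue x))"
    unfolding bounded_on_square_def by (intro bdd_aboveI[of _ "8 * \<kappa> ^ 5 + 2"]) auto
  show "\<not> separately_continuous q (Ave q (glue x))"
  proof
    assume "separately_continuous q (Ave q (glue x))"
    then have lim: "limitin (quasi_norm_topology q) (Ave q (glue x) 0) (Ave q (glue x) 0 0) (at 0 within {0..1})"
      by (auto simp: separately_continuous_def)
    have "glue x 0 = 0"
      by (rule glue_eq_0) (simp add: bump_eq_0 less_imp_le[OF t_pos])
    then have "Ave q (glue x) 0 0 = 0" by (simp add: Ave_def)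
    moreover have "1 / (4 * \<kappa>\<^sup>2) > 0" using \<kappa>_pos by simp
    ultimately have "eventually (\<lambda>s. q (Ave q (glue x) 0 s) < 1 / (4 * \<kappa>\<^sup>2)) (at 0 within {0..1})"
      using iffD1[OF limitin_quasi_norm_topology lim, rule_format, of "1 / (4 * \<kappa>\<^sup>2)"] by simp
    then obtain d where d: "d > 0"
      "\<And>s. \<lbrakk>s \<in> {0..1}; s \<noteq> 0; dist s 0 < d\<rbrakk> \<Longrightarrow> q (Ave q (glue x) 0 s) < 1 / (4 * \<kappa>\<^sup>2)"
      unfolding eventually_at by blast
    obtain k where k: "t k < d"
      using order_tendstoD(2)[OF t_tendsto d(1)] unfolding eventually_sequentially by blast
    \<comment> \<open>Since \<open>k \<le> n k\<close>, this block end is at most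
      \<open>t k\<close>, hence within \<open>d\<close> of 0.\<close>
    let ?s = "t (n k)"
    have s: "0 < ?s" "?s \<le> 1" "?s < d"
      using t_pos[of "n k"] t_le_1[of "n k"] k
        t_antimono[OF strict_mono_imp_increasing[OF strict_mono_n, of k]] by auto
    then have "q (Ave q (glue x) 0 ?s) < 1 / (4 * \<kappa>\<^sup>2)"
      by (intro d(2)) (auto simp: dist_real_def)
    moreover have "q (Ave q (glue x) 0 ?s) = q (riemann_integral q (glue x) 0 ?s) / ?s"
      using s by (simp add: Ave_def qnorm_scaleR)
    ultimately have "4 * \<kappa>\<^sup>2 * q (riemann_integral q (glue x) 0 ?s) < ?s"
      using s \<kappa>_pos by (simp add: divide_simps mult_ac split: if_splits)
    then show False using qnorm_integral_block_ge[of k] by simp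
  qed
qed

end

section \<open>Blocks in spaces that are not locally convex\<close>

context quasi_banach_modulus
begin

text \<open>Balls of a quasi-norm need not be open, so open neighbourhoods are produced as
  interiors. If radius \<open>d\<close> works at \<open>x\<close>, then
  \<open>d / (2 * \<kappa>)\<close> works at all points within \<open>d / (2 * \<kappa>)\<close> of
  \<open>x\<close>.\<close>

lemma openin_interior:
  "openin (quasi_norm_topology q) {x. \<exists>d>0. \<forall>y. q (y - x) < d \<longrightarrow> y \<in> V}"
  unfolding openin_quasi_norm_topology
proof (intro ballI)
  fix x assume "x \<in> {x. \<exists>d>0. \<forall>y. q (y - x) < d \<longrightarrow> y \<in> V}"
  then obtain d where d: "d > 0" "\<And>y. q (y - x) < d \<Longrightarrow> y \<in> V" by blast
  define r where "r = d / (2 * \<kappa>)"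
  have r: "r > 0" "\<kappa> * (r + r) = d" using d(1) \<kappa>_pos by (auto simp: r_def)
  have "z \<in> V" if "q (y - x) < r" "q (z - y) < r" for y z
  proof (rule d(2))
    have "q (z - x) \<le> \<kappa> * (q (z - y) + q (y - x))"
      using quasi_triangle[of "z - y" "y - x"] by simp
    also have "\<dots> < \<kappa> * (r + r)"
      using that \<kappa>_pos by (intro mult_strict_left_mono) auto
    finally show "q (z - x) < d" using r by simp
  qed
  then show "\<exists>e>0. \<forall>y. q (y - x) < e \<longrightarrow> y \<in> {x. \<exists>d>0. \<forall>y. q (y - x) < d \<longrightarrow> y \<in> V}"
    using r(1) by blast
qed

text \<open>Scaled copies of the convex hull of the unit ball are convex neighbourhoods of 0;
  boundedness of the hull makes them arbitrarily small.\<close>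

lemma locally_convex_if_convex_hull_bounded:
  assumes bounded: "\<And>z. z \<in> convex hull {y. q y \<le> 1} \<Longrightarrow> q z \<le> M"
  shows "locally_convex_topology (quasi_norm_topology q)"
  unfolding locally_convex_topology_def neighbourhood_base_at_def
proof (intro allI impI)
  fix W assume "openin (quasi_norm_topology q) W \<and> 0 \<in> W"
  then obtain e where e: "e > 0" "\<And>y. q y < e \<Longrightarrow> y \<in> W"
    unfolding openin_quasi_norm_topology by fastforce
  define r where "r = e / (\<bar>M\<bar> + 1)"
  have r: "r > 0" "r * M < e"
    using e(1) by (auto simp: r_def divide_simps abs_if intro: mult_strict_left_mono)
  define V where "V = (\<lambda>y. r *\<^sub>R y) ` (convex hull {y. q y \<le> 1})"
  define U where "U = {x. \<exists>d>0. \<forall>y. q (y - x) < d \<longrightarrow> y \<in> V}"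
  have "openin (quasi_norm_topology q) U"
    unfolding U_def by (rule openin_interior)
  moreover have "convex V"
    unfolding V_def by (intro convex_scaling convex_convex_hull)
  moreover have "y \<in> V" if "q y < r" for y
  proof -
    have "(1 / r) *\<^sub>R y \<in> convex hull {y. q y \<le> 1}"
      using r(1) that by (intro hull_inc) (simp add: qnorm_scaleR)
    moreover have "y = r *\<^sub>R (1 / r) *\<^sub>R y" using r(1) by simp
    ultimately show ?thesis unfolding V_def by blast
  qed
  then have "0 \<in> U" using r(1) by (auto simp: U_def)
  moreover have "U \<subseteq> V" by (force simp: U_def qnorm_zero)
  moreover have "V \<subseteq> W"
  proof
    fix x assume "x \<in> V"
    then obtain y where y: "y \<in> convex hull {y. q y \<le> 1}" "x = r *\<^sub>R y"
      unfolding V_def by blast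
    then have "q x \<le> r * M"
      using r(1) bounded[OF y(1)] by (simp add: qnorm_scaleR)
    then show "x \<in> W" using r(2) e(2) by simp
  qed
  ultimately show "\<exists>U V. openin (quasi_norm_topology q) U \<and> convex V \<and> 0 \<in> U \<and> U \<subseteq> V \<and> V \<subseteq> W"
    by blast
qed

text \<open>Without local convexity the hull of the unit ball is unbounded. Its points are finite
  convex combinations, here enumerated by naturals because contiguous parts will matter.\<close>

lemma large_convex_combination:
  assumes "\<not> locally_convex_topology (quasi_norm_topology q)"
  shows "\<exists>(N::nat) (w::nat \<Rightarrow> real) y. (\<forall>i<N. w i > 0) \<and> (\<Sum>i\<in>{0..<N}. w i) = 1 \<and>
    (\<forall>i<N. q (y i) \<le> 1) \<and> q (\<Sum>i\<in>{0..<N}. w i *\<^sub>R y i) > M"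
proof -
  obtain z where "z \<in> convex hull {y. q y \<le> 1}" and zM: "q z > M"
    using locally_convex_if_convex_hull_bounded[of M] assms not_le by blast
  then obtain S c where S: "finite S" "S \<subseteq> {y. q y \<le> 1}" "\<forall>x\<in>S. 0 \<le> c x" "sum c S = 1"
    "(\<Sum>v\<in>S. c v *\<^sub>R v) = z"
    unfolding convex_hull_explicit by blast
  \<comment> \<open>Zero weights are dropped, since the weights will become lengths of nondegenerate
    intervals.\<close>
  define S' where "S' = {x \<in> S. c x \<noteq> 0}"
  have fin: "finite S'" using S(1) by (simp add: S'_def)
  have sums: "sum c S' = 1" "(\<Sum>v\<in>S'. c v *\<^sub>R v) = z"
    unfolding S(4,5)[symmetric] by (rule sum.mono_neutral_left[OF S(1)]; force simp: S'_def)+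
  obtain h where h: "bij_betw h {0..<card S'} S'"
    using ex_bij_betw_nat_finite[OF fin] by blast
  have hS: "h i \<in> S'" if "i < card S'" for i
    using that bij_betwE[OF h] by simp
  show ?thesis
  proof (intro exI[of _ "card S'"] exI[of _ "\<lambda>i. c (h i)"] exI[of _ h] conjI allI impI)
    show "c (h i) > 0" "q (h i) \<le> 1" if "i < card S'" for i
      using hS[OF that] S(2,3) by (auto simp: S'_def less_le)
    show "(\<Sum>i\<in>{0..<card S'}. c (h i)) = 1"
      using sum.reindex_bij_betw[OF h, of c] sums by simp
    show "M < q (\<Sum>i\<in>{0..<card S'}. c (h i) *\<^sub>R h i)"
      using sum.reindex_bij_betw[OF h, of "\<lambda>v. c v *\<^sub>R v"] sums zM by simp
  qed
qed

text \<open>The bound on contiguous averages is written without division, so that it includes empty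
  ranges.\<close>

definition unit_block :: "nat \<Rightarrow> (nat \<Rightarrow> real) \<Rightarrow> (nat \<Rightarrow> 'a) \<Rightarrow> bool" where
  "unit_block N w y \<longleftrightarrow> (\<forall>i<N. w i > 0) \<and> (\<Sum>i\<in>{0..<N}. w i) = 1 \<and>
     (\<forall>u v. u \<le> v \<longrightarrow> v \<le> N \<longrightarrow> q (\<Sum>i\<in>{u..<v}. w i *\<^sub>R y i) \<le> (\<Sum>i\<in>{u..<v}. w i)) \<and>
     q (\<Sum>i\<in>{0..<N}. w i *\<^sub>R y i) = 1"

text \<open>Among the averages over contiguous parts of a convex combination of large quasi-norm, one of
  maximal quasi-norm, normalised, gives a unit block.\<close>

lemma exists_unit_block:
  assumes nlc: "\<not> locally_convex_topology (quasi_norm_topology q)" and "e > 0"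
  shows "\<exists>N w y. unit_block N w y \<and> (\<forall>i<N. q (y i) \<le> e)"
proof -
  obtain N :: nat and w :: "nat \<Rightarrow> real" and y where
    w: "\<And>i. i < N \<Longrightarrow> w i > 0" and sum_w: "(\<Sum>i\<in>{0..<N}. w i) = 1" and y: "\<And>i. i < N \<Longrightarrow> q (y i) \<le> 1"
    and big: "q (\<Sum>i\<in>{0..<N}. w i *\<^sub>R y i) > 1 / e"
    using large_convex_combination[OF nlc, of "1 / e"] by blast
  define W where "W u v = (\<Sum>i\<in>{u..<v}. w i)" for u v
  define Q where "Q u v = q (\<Sum>i\<in>{u..<v}. w i *\<^sub>R y i)" for u v
  define P where "P = {(u, v). u < v \<and> v \<le> N}"
  define R where "R = (\<lambda>(u, v). Q u v / W u v) ` P"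
  have "N > 0" using sum_w by (cases N) auto
  then have N: "(0, N) \<in> P" by (simp add: P_def)
  have "finite P"
    by (rule finite_subset[of _ "{..N} \<times> {..N}"]) (auto simp: P_def)
  then have fin: "finite R" by (simp add: R_def)
  have "Max R \<in> R" using fin N by (intro Max_in) (auto simp: R_def)
  then obtain u0 v0 where uv: "u0 < v0" "v0 \<le> N" "Max R = Q u0 v0 / W u0 v0"
    by (auto simp: R_def P_def)
  have W_pos: "W u v > 0" if "u < v" "v \<le> N" for u v
    unfolding W_def using that w by (intro sum_pos) auto
  define m where "m = Max R"
  have Q_le: "Q u v \<le> m * W u v" if "u < v" "v \<le> N" for u v
  proof -
    have "Q u v / W u v \<le> m"
      unfolding m_def using that fin by (intro Max_ge) (auto simp: R_def P_def)
    then show ?thesis using W_pos[OF that] by (simp add: divide_le_eq)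
  qed
  \<comment> \<open>The whole combination competes in the maximum, so \<open>m\<close> exceeds
    \<open>1 / e\<close>; dividing the vectors by \<open>m\<close> then brings them below
    \<open>e\<close>.\<close>
  have em: "1 / e < m"
    using Q_le[OF \<open>N > 0\<close> order_refl] big sum_w by (simp add: Q_def W_def)
  have m: "m > 0"
    using em \<open>e > 0\<close> by (meson less_trans zero_less_divide_1_iff)
  have m_e: "1 / m \<le> e"
    using em m \<open>e > 0\<close> by (simp add: pos_divide_less_eq pos_divide_le_eq mult.commute)
  have W0: "W u0 v0 > 0" by (rule W_pos[OF uv(1,2)])
  have Q0: "Q u0 v0 = m * W u0 v0" using uv(3) W0 by (simp add: m_def)
  define w' where "w' i = w (u0 + i) / W u0 v0" for i
  define y' where "y' i = (1 / m) *\<^sub>R y (u0 + i)" for i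
  have sum_w': "(\<Sum>i\<in>{a..<b}. w' i) = W (u0 + a) (u0 + b) / W u0 v0" for a b
    unfolding w'_def W_def sum_divide_distrib[symmetric]
    by (simp add: sum.shift_bounds_nat_ivl add.commute)
  have q_sum: "q (\<Sum>i\<in>{a..<b}. w' i *\<^sub>R y' i) = Q (u0 + a) (u0 + b) / (m * W u0 v0)" for a b
  proof -
    have "(\<Sum>i\<in>{a..<b}. w' i *\<^sub>R y' i) = (1 / (m * W u0 v0)) *\<^sub>R (\<Sum>i\<in>{a..<b}. w (u0 + i) *\<^sub>R y (u0 + i))"
      unfolding scaleR_sum_right w'_def y'_def by (rule sum.cong) (auto simp: mult.commute)
    also have "(\<Sum>i\<in>{a..<b}. w (u0 + i) *\<^sub>R y (u0 + i)) = (\<Sum>i\<in>{u0 + a..<u0 + b}. w i *\<^sub>R y i)"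
      using sum.shift_bounds_nat_ivl[of "\<lambda>i. w i *\<^sub>R y i" a u0 b] by (simp add: add.commute)
    finally show ?thesis
      using m W0 by (simp add: qnorm_scaleR Q_def)
  qed
  have "unit_block (v0 - u0) w' y'"
    unfolding unit_block_def
  proof (intro conjI allI impI)
    show "w' i > 0" if "i < v0 - u0" for i
      using that uv(2) W0 w[of "u0 + i"] by (simp add: w'_def)
    show "(\<Sum>i\<in>{0..<v0 - u0}. w' i) = 1"
      using W0 uv(1) by (simp add: sum_w')
    show "q (\<Sum>i\<in>{0..<v0 - u0}. w' i *\<^sub>R y' i) = 1"
      using W0 m uv(1) by (simp add: q_sum Q0)
    fix u v assume "u \<le> v" "v \<le> v0 - u0"
    show "q (\<Sum>i\<in>{u..<v}. w' i *\<^sub>R y' i) \<le> (\<Sum>i\<in>{u..<v}. w' i)"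
    proof (cases "u = v")
      case False
      then have "Q (u0 + u) (u0 + v) \<le> m * W (u0 + u) (u0 + v)"
        using \<open>u \<le> v\<close> \<open>v \<le> v0 - u0\<close> uv by (intro Q_le) auto
      then have "Q (u0 + u) (u0 + v) / (m * W u0 v0) \<le> m * W (u0 + u) (u0 + v) / (m * W u0 v0)"
        using m W0 by (intro divide_right_mono) auto
      then show ?thesis using m by (simp add: q_sum sum_w')
    qed (simp add: qnorm_zero)
  qed
  moreover have "q (y' i) \<le> e" if "i < v0 - u0" for i
  proof -
    have "q (y (u0 + i)) \<le> 1" using that uv(2) by (intro y) auto
    then have "(1 / m) * q (y (u0 + i)) \<le> (1 / m) * 1"
      using m by (intro mult_left_mono) auto
    then show ?thesis using m m_e by (simp add: y'_def qnorm_scaleR)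
  qed
  ultimately show ?thesis by blast
qed

text \<open>The \<open>k\<close>-th block gets length proportional to \<open>\<theta> ^ n (Suc k)\<close>, so that the \<open>j\<close>-th interval is
  not longer than a multiple of \<open>\<theta> ^ Suc j\<close>, however many intervals the blocks have.\<close>

lemma exists_block_series:
  assumes nlc: "\<not> locally_convex_topology (quasi_norm_topology q)"
  shows "\<exists>t x n. block_series q \<kappa> t x n"
proof -
  \<comment> \<open>The bound \<open>1 / real (Suc k)\<close> on the \<open>k\<close>-th block makes
    the concatenated sequence tend to 0 and stay within quasi-norm 1.\<close>
  have "\<forall>k. \<exists>N w y. unit_block N w y \<and> (\<forall>i<N. q (y i) \<le> 1 / real (Suc k))"
    by (intro allI exists_unit_block nlc) simp
  then obtain N w y where block: "\<And>k. unit_block (N k) (w k) (y k)"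
    and y: "\<And>k i. i < N k \<Longrightarrow> q (y k i) \<le> 1 / real (Suc k)"
    by metis
  have w_pos: "w k i > 0" if "i < N k" for k i
    using block[of k] that by (auto simp: unit_block_def)
  have sum_w: "(\<Sum>i\<in>{0..<N k}. w k i) = 1" for k
    using block[of k] by (auto simp: unit_block_def)
  have part: "q (\<Sum>i\<in>{u..<v}. w k i *\<^sub>R y k i) \<le> (\<Sum>i\<in>{u..<v}. w k i)" if "u \<le> v" "v \<le> N k" for u v k
    using block[of k] that by (auto simp: unit_block_def)
  have full: "q (\<Sum>i\<in>{0..<N k}. w k i *\<^sub>R y k i) = 1" for k
    using block[of k] by (auto simp: unit_block_def)
  have w_le: "w k i \<le> 1" if "i < N k" for k i
    unfolding sum_w[of k, symmetric] using that w_pos[of _ k]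
    by (intro member_le_sum) (auto intro: less_imp_le)
  have N_pos: "N k > 0" for k
    using sum_w[of k] by (cases "N k") auto
  define n where "n k = (\<Sum>i<k. N i)" for k
  have n_Suc: "n (Suc k) = n k + N k" and n_0: "n 0 = 0" for k
    by (simp_all add: n_def)
  have mono_n: "strict_mono n"
    using N_pos by (auto simp: strict_mono_Suc_iff n_Suc)
  \<comment> \<open>The number of the block containing \<open>j\<close>; the position inside it is
    \<open>j - n (B j)\<close>.\<close>
  define B where "B j = (THE k. n k \<le> j \<and> j < n (Suc k))" for j
  have B_eq: "B j = k" if "n k \<le> j" "j < n (Suc k)" for j k
    unfolding B_def
  proof (rule the_equality)
    fix i assume i: "n i \<le> j \<and> j < n (Suc i)"
    then have "n i < n (Suc k)" "n k < n (Suc i)" using that by auto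
    then show "i = k"
      using strict_mono_less[OF mono_n] by (meson less_Suc_eq_le le_antisym)
  qed (use that in auto)
  have B: "n (B j) \<le> j" "j < n (Suc (B j))" for j
  proof -
    obtain k where k: "n k \<le> j" "j < n (Suc k)"
      using strict_mono_block[OF mono_n n_0] .
    then show "n (B j) \<le> j" "j < n (Suc (B j))"
      by (simp_all add: B_eq[OF k])
  qed
  have block_sum: "(\<Sum>j\<in>{u..<v}. g (B j) (j - n (B j))) = (\<Sum>i\<in>{u - n k..<v - n k}. g k i)"
    if "n k \<le> u" "u \<le> v" "v \<le> n (Suc k)" for u v k and g :: "nat \<Rightarrow> nat \<Rightarrow> 'b::comm_monoid_add"
  proof (rule sum.reindex_bij_witness[where i = "\<lambda>i. i + n k" and j = "\<lambda>j. j - n k"])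
    fix j assume "j \<in> {u..<v}"
    then have "B j = k" using that by (intro B_eq) auto
    then show "g k (j - n k) = g (B j) (j - n (B j))" by simp
  qed (use that in auto)
  \<comment> \<open>What follows a block is at most \<open>2 * \<theta>\<close> times as long as it,
    so \<open>4 * \<kappa>\<^sup>2 * (2 * \<theta>) = 1\<close> gives the required decay. Also
    \<open>\<kappa> * \<theta> < 1\<close>, which gives summability.\<close>
  define \<theta> where "\<theta> = 1 / (8 * \<kappa>\<^sup>2)"
  have \<kappa>2: "\<kappa>\<^sup>2 \<ge> 1" using \<kappa>_ge_1 by (rule one_le_power)
  have \<theta>: "\<theta> > 0" "\<theta> \<le> 1 / 8" "4 * \<kappa>\<^sup>2 * (2 * \<theta>) = 1"
    using \<kappa>2 by (auto simp: \<theta>_def divide_simps)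
  have \<kappa>\<theta>: "0 \<le> \<kappa> * \<theta>" "\<kappa> * \<theta> < 1"
  proof -
    have "\<kappa> * \<theta> \<le> \<kappa>\<^sup>2 * \<theta>"
      using \<kappa>_ge_1 \<theta>(1) by (intro mult_right_mono) (auto simp: power2_eq_square)
    then show "\<kappa> * \<theta> < 1" using \<theta>(3) by simp
  qed (use \<kappa>_pos \<theta>(1) in simp)
  \<comment> \<open>Lengths before normalisation. The exponent is the first index after the block,
    so it is at least \<open>Suc j\<close> for every \<open>j\<close> in the block.\<close>
  define a where "a j = \<theta> ^ n (Suc (B j)) * w (B j) (j - n (B j))" for j
  have in_block: "j - n (B j) < N (B j)" for j
    using B[of j] by (auto simp: n_Suc)
  have a_pos: "a j > 0" for j
    using \<theta>(1) w_pos[OF in_block] by (simp add: a_def)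
  have a_le: "a j \<le> \<theta> ^ Suc j" for j
  proof -
    have "a j \<le> \<theta> ^ n (Suc (B j)) * 1"
      unfolding a_def using \<theta>(1) w_le[OF in_block] by (intro mult_left_mono) auto
    also have "\<dots> \<le> \<theta> ^ Suc j"
      using \<theta> B(2)[of j] by (simp del: power_Suc)
    finally show ?thesis .
  qed
  have geometric: "summable (\<lambda>j. c ^ Suc j)" if "0 \<le> c" "c < 1" for c :: real
    using that by (intro summable_Suc_iff[THEN iffD2] summable_geometric) simp
  have summable_a: "summable a"
    by (rule summable_comparison_test'[OF geometric[of \<theta>], of 0])
      (use \<theta> a_le less_imp_le[OF a_pos] in auto)
  define T where "T = suminf a"
  have T: "T > 0" unfolding T_def by (intro suminf_pos summable_a a_pos)
  \<comment> \<open>Dividing by the total length \<open>T\<close> makes the partition points run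
    from 1 down to 0.\<close>
  define t where "t j = 1 - (\<Sum>i<j. a i) / T" for j
  define x where "x j = y (B j) (j - n (B j))" for j
  interpret null_partition t
  proof
    show "t 0 = 1" by (simp add: t_def)
    show "t (Suc j) < t j" for j
      using a_pos[of j] T by (simp add: t_def divide_strict_right_mono)
    have "(\<lambda>j. 1 - (\<Sum>i<j. a i) / T) \<longlonglongrightarrow> 1 - T / T"
      unfolding T_def using summable_LIMSEQ[OF summable_a] T
      by (intro tendsto_intros) (auto simp: T_def)
    then show "t \<longlonglongrightarrow> 0" using T by (simp add: t_def[abs_def])
  qed
  have len_eq: "len j = a j / T" for j
    by (simp add: len_def t_def add_divide_distrib)
  \<comment> \<open>A geometric series with \<open>1 / (1 - \<theta>) \<le> 2\<close>. For
    \<open>m = n (Suc k)\<close> the factor \<open>\<theta> ^ m / T\<close> is the length of block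
    \<open>k\<close>.\<close>
  have tail: "t m \<le> 2 * \<theta> * (\<theta> ^ m / T)" for m
  proof -
    have "t m * T = T - (\<Sum>i<m. a i)"
      using T by (simp add: t_def left_diff_distrib)
    also have "\<dots> = (\<Sum>i. a (i + m))"
      unfolding T_def by (rule suminf_minus_initial_segment[OF summable_a, symmetric])
    also have "\<dots> \<le> (\<Sum>i. \<theta> ^ Suc m * \<theta> ^ i)"
    proof (rule suminf_le)
      show "a (i + m) \<le> \<theta> ^ Suc m * \<theta> ^ i" for i
        using a_le[of "i + m"] by (simp add: power_add mult_ac)
      show "summable (\<lambda>i. a (i + m))" using summable_a by (simp add: summable_iff_shift)
      show "summable (\<lambda>i. \<theta> ^ Suc m * \<theta> ^ i)"
        using \<theta> by (intro summable_mult summable_geometric) simp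
    qed
    also have "\<dots> = \<theta> ^ Suc m * (1 / (1 - \<theta>))"
      using \<theta> by (subst suminf_mult) (auto simp: suminf_geometric summable_geometric)
    also have "\<dots> \<le> \<theta> ^ Suc m * 2"
      using \<theta> by (intro mult_left_mono) (auto simp: divide_simps)
    finally show ?thesis using T by (simp add: pos_le_divide_eq mult_ac)
  qed
  have sum_block: "(\<Sum>j\<in>{u..<v}. len j *\<^sub>R x j) = (\<theta> ^ n (Suc k) / T) *\<^sub>R (\<Sum>i\<in>{u - n k..<v - n k}. w k i *\<^sub>R y k i)"
    "t u - t v = (\<theta> ^ n (Suc k) / T) * (\<Sum>i\<in>{u - n k..<v - n k}. w k i)"
    if uv: "n k \<le> u" "u \<le> v" "v \<le> n (Suc k)" for u v k
  proof -
    show "(\<Sum>j\<in>{u..<v}. len j *\<^sub>R x j) = (\<theta> ^ n (Suc k) / T) *\<^sub>R (\<Sum>i\<in>{u - n k..<v - n k}. w k i *\<^sub>R y k i)"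
      using block_sum[OF uv, of "\<lambda>k i. (\<theta> ^ n (Suc k) * w k i / T) *\<^sub>R y k i"]
      by (simp add: len_eq a_def x_def scaleR_sum_right)
    show "t u - t v = (\<theta> ^ n (Suc k) / T) * (\<Sum>i\<in>{u - n k..<v - n k}. w k i)"
      using block_sum[OF uv, of "\<lambda>k i. \<theta> ^ n (Suc k) * w k i / T"] sum_len[OF uv(2)]
      by (simp add: len_eq a_def sum_distrib_left)
  qed
  have n_le: "n k \<le> n (Suc k)" for k by (simp add: n_Suc)
  have block_len: "t (n k) - t (n (Suc k)) = \<theta> ^ n (Suc k) / T" for k
    using sum_block(2)[of k "n k" "n (Suc k)"] n_le sum_w by (simp add: n_Suc)
  have qx: "q (x j) \<le> 1 / real (Suc (B j))" for j
    unfolding x_def by (rule y[OF in_block])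
  have "block_series q \<kappa> t x n"
  proof
    show "summable (\<lambda>j. \<kappa> ^ Suc j * len j)"
    proof (rule summable_comparison_test'[of "\<lambda>j. (\<kappa> * \<theta>) ^ Suc j * (1 / T)" 0])
      show "summable (\<lambda>j. (\<kappa> * \<theta>) ^ Suc j * (1 / T))"
        by (intro summable_mult2 geometric \<kappa>\<theta>)
      show "norm (\<kappa> ^ Suc j * len j) \<le> (\<kappa> * \<theta>) ^ Suc j * (1 / T)" for j
      proof -
        have "norm (\<kappa> ^ Suc j * len j) = \<kappa> ^ Suc j * (a j / T)"
          using \<kappa>_pos T less_imp_le[OF a_pos[of j]] by (simp add: len_eq abs_mult)
        also have "\<dots> \<le> \<kappa> ^ Suc j * (\<theta> ^ Suc j / T)"
          using \<kappa>_pos T a_le[of j] by (intro mult_left_mono divide_right_mono) auto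
        finally show ?thesis by (simp add: power_mult_distrib mult_ac)
      qed
    qed
    show "q (x j) \<le> 1" for j
      by (rule order_trans[OF qx]) simp
    show "(\<lambda>j. q (x j)) \<longlonglongrightarrow> 0"
    proof (rule tendsto_sandwich[of "\<lambda>_. 0" _ _ "\<lambda>j. 1 / real (Suc (B j))"])
      have "filterlim B at_top sequentially"
        unfolding filterlim_at_top eventually_sequentially
      proof
        fix K
        show "\<exists>M. \<forall>j\<ge>M. K \<le> B j"
        proof (intro exI allI impI)
          fix j assume "n K \<le> j"
          then have "n K < n (Suc (B j))" using B(2)[of j] by simp
          then show "K \<le> B j" using strict_mono_less[OF mono_n] by auto
        qed
      qed
      then show "(\<lambda>j. 1 / real (Suc (B j))) \<longlonglongrightarrow> 0"
        using filterlim_compose[OF LIMSEQ_Suc[OF lim_1_over_n]] by fastforce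
    qed (use qx in auto)
    show "strict_mono n" "n 0 = 0" by fact+
    show "q (\<Sum>j\<in>{u..<v}. len j *\<^sub>R x j) \<le> t u - t v" if "n k \<le> u" "u \<le> v" "v \<le> n (Suc k)" for k u v
    proof -
      have "q (\<Sum>j\<in>{u..<v}. len j *\<^sub>R x j)
          = \<theta> ^ n (Suc k) / T * q (\<Sum>i\<in>{u - n k..<v - n k}. w k i *\<^sub>R y k i)"
        using \<theta>(1) T by (simp add: sum_block(1)[OF that] qnorm_scaleR)
      also have "\<dots> \<le> \<theta> ^ n (Suc k) / T * (\<Sum>i\<in>{u - n k..<v - n k}. w k i)"
        using \<theta>(1) T that by (intro mult_left_mono part) (auto simp: n_Suc)
      finally show ?thesis by (simp only: sum_block(2)[OF that])
    qed
    show "q (\<Sum>j\<in>{n k..<n (Suc k)}. len j *\<^sub>R x j) = t (n k) - t (n (Suc k))" for k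
      using sum_block(1)[of k "n k" "n (Suc k)"] n_le full[of k] block_len[of k] \<theta>(1) T
      by (simp add: n_Suc qnorm_scaleR)
    show "4 * \<kappa>\<^sup>2 * t (n (Suc k)) \<le> t (n k) - t (n (Suc k))" for k
    proof -
      have "4 * \<kappa>\<^sup>2 * t (n (Suc k)) \<le> 4 * \<kappa>\<^sup>2 * (2 * \<theta> * (\<theta> ^ n (Suc k) / T))"
        by (intro mult_left_mono tail) simp
      also have "\<dots> = (4 * \<kappa>\<^sup>2 * (2 * \<theta>)) * (\<theta> ^ n (Suc k) / T)"
        by (simp only: mult.assoc)
      finally show ?thesis by (simp only: \<theta>(3) block_len mult_1)
    qed
  qed
  then show ?thesis by blast
qed

end

theorem theorem1p4:
  fixes q :: "'a::real_vector \<Rightarrow> real"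
  assumes "quasi_banach_space q"
    and "\<not> locally_convex_topology (quasi_norm_topology q)"
  shows "\<exists>f :: real \<Rightarrow> 'a.
    continuous_map (top_of_set {0..1}) (quasi_norm_topology q) f \<and>
    riemann_integrable q f 0 1 \<and>
    bounded_on_square q (Ave q f) \<and>
    \<not> separately_continuous q (Ave q f)"
proof -
  interpret quasi_banach_space q by fact
  obtain \<kappa> where "\<kappa> \<ge> 1" "\<And>x y. q (x + y) \<le> \<kappa> * (q x + q y)"
    using qnorm_quasi_triangle by blast
  then interpret quasi_banach_modulus q \<kappa>
    by unfold_locales
  obtain t x n where "block_series q \<kappa> t x n"
    using exists_block_series assms(2) by blast
  then interpret block_series q \<kappa> t x n .
  show ?thesis
    using bounded_not_separately_continuous by blast
qed

end
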